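(* Let $(M,F)$ be an AR-Finsler manifold of dimension $n\geq 2$, with $g_{ij}=\eta\,a_{ij}$, such that $F(x,y)$ is not a rational function in $y$ and the functions $\partial_i\log(\eta(x,y))$ are rational in $y$ for all $i$. If $(M,F)$ has isotropic mean Landsberg curvature, then $(M,F)$ is a weakly Landsberg manifold.
   Context: $M$ is a smooth $n$-dimensional manifold with local coordinates $(x^i)$ and induced fibre coordinates $(y^i)$ on $TM$; $\partial_i=\partial/\partial x^i$, $\dot{\partial}_i=\partial/\partial y^i$; the summation convention is used. A Finsler metric on $M$ is a map $F:TM\to[0,\infty)$ which is $C^\infty$ on $TM\setminus\{0\}$, positively homogeneous of degree one in $y$, and such that $g_{ij}(x,y):=\frac12\dot{\partial}_i\dot{\partial}_jF^2$ is positive definite at each point of $TM\setminus\{0\}$; $(g^{ij})$ is the inverse matrix. "Rational in $y$" means: locally in $x$, a quotient of two polynomials in $y$ whose coefficients are smooth functions of $x$; "$F$ is not a rational function in $y$" means that for no point $x\in M$ is $F(x,\cdot)$ a rational function of $y$. $F$ is an AR-Finsler metric (and $(M,F)$ an AR-Finsler manifold) if $g_{ij}(x,y)=\eta(x,y)\,a_{ij}(x,y)$ where (a) $\eta:TM\setminus\{0\}\to[0,\infty)$ is smooth; (b) $(a_{ij}(x,y))$ is a symmetric positive definite matrix with each $a_{ij}$ rational in $y$; (c) each product $\eta\,a_{ij}$ is positively homogeneous of degree zero in $y$. Such a decomposition is fixed. Cartan torsion: $C_{ijk}=\frac12\dot{\partial}_kg_{ij}$; mean Cartan torsion: $I_k=g^{ij}C_{ijk}$.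 Spray coefficients: $G^i=\frac14 g^{ir}\left(y^k\dot{\partial}_r\partial_kF^2-\partial_rF^2\right)$; Berwald curvature: $G^i_{jkl}=\dot{\partial}_j\dot{\partial}_k\dot{\partial}_lG^i$. Landsberg curvature: $L_{ijk}=\frac12 y^mg_{ms}G^s_{ijk}$; mean Landsberg curvature: $J_k=g^{ij}L_{ijk}$. $(M,F)$ is weakly Landsberg if $J_k=0$ for all $k$, and has isotropic mean Landsberg curvature if $J_k(x,y)=A(x)\,F(x,y)\,I_k(x,y)$ for all $k$, for some $A\in C^\infty(M)$. *)

theory Defs
  imports "HOL-Analysis.Analysis"
begin

section \<open>Smooth manifolds and the tangent bundle\<close>

text \<open>\<open>C\<^sup>k\<close> and \<open>C\<^sup>\<infinity>\<close> functions on an open subset of a normed space. Both notions are meant for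
  open \<open>S\<close> only.\<close>

primrec Ck_on :: "nat \<Rightarrow> ('a::real_normed_vector \<Rightarrow> 'b::real_normed_vector) \<Rightarrow> 'a set \<Rightarrow> bool" where
  "Ck_on 0 f S \<longleftrightarrow> continuous_on S f"
| "Ck_on (Suc k) f S \<longleftrightarrow> (\<forall>x\<in>S. f differentiable (at x)) \<and>
     (\<forall>v. Ck_on k (\<lambda>x. frechet_derivative f (at x) v) S)"

definition smooth_on :: "'a::real_normed_vector set \<Rightarrow> ('a \<Rightarrow> 'b::real_normed_vector) \<Rightarrow> bool" where
  "smooth_on S f \<longleftrightarrow> (\<forall>k. Ck_on k f S)"

text \<open>A chart is a pair of its domain and its coordinate map; values of the map outside the
  domain are irrelevant.\<close>

type_synonym ('a, 'n) chart = "'a set \<times> ('a \<Rightarrow> real ^ 'n)"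

definition chart_image :: "('a, 'n::finite) chart \<Rightarrow> (real ^ 'n) set" where
  "chart_image c = snd c ` fst c"

definition chart_inv :: "('a, 'n::finite) chart \<Rightarrow> real ^ 'n \<Rightarrow> 'a" where
  "chart_inv c = inv_into (fst c) (snd c)"

definition smooth_manifold :: "'a topology \<Rightarrow> ('a, 'n::finite) chart set \<Rightarrow> bool" where
  "smooth_manifold M \<A> \<longleftrightarrow>
     Hausdorff_space M \<and> second_countable M \<and>
     (\<Union>c\<in>\<A>. fst c) = topspace M \<and>
     (\<forall>c\<in>\<A>. openin M (fst c) \<and> open (chart_image c) \<and>
        homeomorphic_map (subtopology M (fst c)) (top_of_set (chart_image c)) (snd c)) \<and>
     (\<forall>c\<in>\<A>. \<forall>d\<in>\<A>. smooth_on (snd c ` (fst c \<inter> fst d)) (snd d \<circ> chart_inv c))"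

text \<open>Derivative at \<open>p\<close> of the change of coordinates from \<open>c\<close> to \<open>d\<close>.\<close>

definition chart_change :: "'a \<Rightarrow> ('a, 'n::finite) chart \<Rightarrow> ('a, 'n) chart \<Rightarrow> real ^ 'n \<Rightarrow> real ^ 'n" where
  "chart_change p c d = frechet_derivative (snd d \<circ> chart_inv c) (at (snd c p))"

text \<open>A tangent vector at \<open>p\<close> is the family of its component vectors with respect to the charts around
  \<open>p\<close>, related by the derivatives of the coordinate changes (and \<open>0\<close> at irrelevant charts, so
  that the representation is unique).\<close>

type_synonym ('a, 'n) tangent = "('a, 'n) chart \<Rightarrow> real ^ 'n"

definition tangent_space :: "('a, 'n::finite) chart set \<Rightarrow> 'a \<Rightarrow> ('a, 'n) tangent set" where
  "tangent_space \<A> p =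
     {v. (\<forall>c. \<not> (c \<in> \<A> \<and> p \<in> fst c) \<longrightarrow> v c = 0) \<and>
         (\<forall>c\<in>\<A>. \<forall>d\<in>\<A>. p \<in> fst c \<and> p \<in> fst d \<longrightarrow> v d = chart_change p c d (v c))}"

definition tangent_bundle :: "'a topology \<Rightarrow> ('a, 'n::finite) chart set \<Rightarrow> ('a \<times> ('a, 'n) tangent) set" where
  "tangent_bundle M \<A> = (SIGMA p:topspace M. tangent_space \<A> p)"

definition slit_tangent_bundle :: "'a topology \<Rightarrow> ('a, 'n::finite) chart set \<Rightarrow> ('a \<times> ('a, 'n) tangent) set" where
  "slit_tangent_bundle M \<A> = {(p, v) \<in> tangent_bundle M \<A>. v \<noteq> (\<lambda>c. 0)}"

text \<open>The tangent vector \<open>y\<^sup>i \<partial>/\<partial>x\<^sup>i\<close> at \<open>p\<close>, where \<open>(x\<^sup>i)\<close> are the coordinates of \<open>c\<close>.\<close>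

definition tangent_of_coords :: "('a, 'n::finite) chart set \<Rightarrow> ('a, 'n) chart \<Rightarrow> 'a \<Rightarrow> real ^ 'n \<Rightarrow> ('a, 'n) tangent" where
  "tangent_of_coords \<A> c p y = (\<lambda>d. if d \<in> \<A> \<and> p \<in> fst d then chart_change p c d y else 0)"

text \<open>The expression \<open>f(x, y)\<close> of a function on \<open>TM\<close> in the induced coordinates of \<open>TM\<close>; it is
  meaningful for \<open>x\<close> in \<open>chart_image c\<close>.\<close>

definition local_rep :: "('a, 'n::finite) chart set \<Rightarrow> ('a, 'n) chart \<Rightarrow> ('a \<times> ('a, 'n) tangent \<Rightarrow> real) \<Rightarrow>
    real ^ 'n \<Rightarrow> real ^ 'n \<Rightarrow> real" where
  "local_rep \<A> c f x y = f (chart_inv c x, tangent_of_coords \<A> c (chart_inv c x) y)"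

definition smooth_on_manifold :: "('a, 'n::finite) chart set \<Rightarrow> ('a \<Rightarrow> real) \<Rightarrow> bool" where
  "smooth_on_manifold \<A> A \<longleftrightarrow> (\<forall>c\<in>\<A>. smooth_on (chart_image c) (A \<circ> chart_inv c))"

definition smooth_on_slit :: "('a, 'n::finite) chart set \<Rightarrow> ('a \<times> ('a, 'n) tangent \<Rightarrow> real) \<Rightarrow> bool" where
  "smooth_on_slit \<A> f \<longleftrightarrow>
     (\<forall>c\<in>\<A>. smooth_on (chart_image c \<times> (UNIV - {0})) (\<lambda>(x, y). local_rep \<A> c f x y))"


section \<open>Finsler geometry in induced coordinates\<close>

text \<open>\<open>dx i\<close> is \<open>\<partial>\<^sub>i = \<partial>/\<partial>x\<^sup>i\<close> and \<open>dy i\<close> is \<open>\<partial>/\<partial>y\<^sup>i\<close>, on functions of \<open>(x, y)\<close>.\<close>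

definition dx :: "'n::finite \<Rightarrow> (real ^ 'n \<Rightarrow> real ^ 'n \<Rightarrow> real) \<Rightarrow> real ^ 'n \<Rightarrow> real ^ 'n \<Rightarrow> real" where
  "dx i f x y = deriv (\<lambda>t. f (x + t *\<^sub>R axis i 1) y) 0"

definition dy :: "'n::finite \<Rightarrow> (real ^ 'n \<Rightarrow> real ^ 'n \<Rightarrow> real) \<Rightarrow> real ^ 'n \<Rightarrow> real ^ 'n \<Rightarrow> real" where
  "dy i f x y = deriv (\<lambda>t. f x (y + t *\<^sub>R axis i 1)) 0"

text \<open>In the following definitions \<open>F\<close> is the expression of the Finsler metric in the induced
  coordinates of a chart.\<close>

definition Fsq :: "(real ^ 'n::finite \<Rightarrow> real ^ 'n \<Rightarrow> real) \<Rightarrow> real ^ 'n \<Rightarrow> real ^ 'n \<Rightarrow> real" where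
  "Fsq F x y = (F x y)\<^sup>2"

definition metric :: "(real ^ 'n::finite \<Rightarrow> real ^ 'n \<Rightarrow> real) \<Rightarrow> real ^ 'n \<Rightarrow> real ^ 'n \<Rightarrow> real ^ 'n ^ 'n" where
  "metric F x y = (\<chi> i j. 1/2 * dy i (dy j (Fsq F)) x y)"

definition metric_inv :: "(real ^ 'n::finite \<Rightarrow> real ^ 'n \<Rightarrow> real) \<Rightarrow> real ^ 'n \<Rightarrow> real ^ 'n \<Rightarrow> real ^ 'n ^ 'n" where
  "metric_inv F x y = matrix_inv (metric F x y)"

definition cartan :: "(real ^ 'n::finite \<Rightarrow> real ^ 'n \<Rightarrow> real) \<Rightarrow> 'n \<Rightarrow> 'n \<Rightarrow> 'n \<Rightarrow> real ^ 'n \<Rightarrow> real ^ 'n \<Rightarrow> real" where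
  "cartan F i j k x y = 1/2 * dy k (\<lambda>x y. metric F x y $ i $ j) x y"

definition mean_cartan :: "(real ^ 'n::finite \<Rightarrow> real ^ 'n \<Rightarrow> real) \<Rightarrow> 'n \<Rightarrow> real ^ 'n \<Rightarrow> real ^ 'n \<Rightarrow> real" where
  "mean_cartan F k x y = (\<Sum>i\<in>UNIV. \<Sum>j\<in>UNIV. metric_inv F x y $ i $ j * cartan F i j k x y)"

definition spray :: "(real ^ 'n::finite \<Rightarrow> real ^ 'n \<Rightarrow> real) \<Rightarrow> 'n \<Rightarrow> real ^ 'n \<Rightarrow> real ^ 'n \<Rightarrow> real" where
  "spray F i x y = 1/4 * (\<Sum>r\<in>UNIV. metric_inv F x y $ i $ r *
     ((\<Sum>k\<in>UNIV. y $ k * dy r (dx k (Fsq F)) x y) - dx r (Fsq F) x y))"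

definition berwald :: "(real ^ 'n::finite \<Rightarrow> real ^ 'n \<Rightarrow> real) \<Rightarrow> 'n \<Rightarrow> 'n \<Rightarrow> 'n \<Rightarrow> 'n \<Rightarrow> real ^ 'n \<Rightarrow> real ^ 'n \<Rightarrow> real" where
  "berwald F i j k l = dy j (dy k (dy l (spray F i)))"

definition landsberg :: "(real ^ 'n::finite \<Rightarrow> real ^ 'n \<Rightarrow> real) \<Rightarrow> 'n \<Rightarrow> 'n \<Rightarrow> 'n \<Rightarrow> real ^ 'n \<Rightarrow> real ^ 'n \<Rightarrow> real" where
  "landsberg F i j k x y =
     1/2 * (\<Sum>m\<in>UNIV. \<Sum>s\<in>UNIV. y $ m * metric F x y $ m $ s * berwald F s i j k x y)"

definition mean_landsberg :: "(real ^ 'n::finite \<Rightarrow> real ^ 'n \<Rightarrow> real) \<Rightarrow> 'n \<Rightarrow> real ^ 'n \<Rightarrow> real ^ 'n \<Rightarrow> real" where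
  "mean_landsberg F k x y = (\<Sum>i\<in>UNIV. \<Sum>j\<in>UNIV. metric_inv F x y $ i $ j * landsberg F i j k x y)"

definition pos_definite :: "real ^ 'n::finite ^ 'n \<Rightarrow> bool" where
  "pos_definite B \<longleftrightarrow> (\<forall>v. v \<noteq> 0 \<longrightarrow> 0 < v \<bullet> (B *v v))"


section \<open>Rationality in the fibre variable\<close>

text \<open>Polynomials in \<open>y\<close> whose coefficients are smooth functions of \<open>x \<in> V\<close>; the index \<open>\<alpha>\<close> runs over
  a finite set of multi-exponents.\<close>

definition fibre_polynomial :: "(real ^ 'n::finite) set \<Rightarrow> (real ^ 'n \<Rightarrow> real ^ 'n \<Rightarrow> real) \<Rightarrow> bool" where
  "fibre_polynomial V P \<longleftrightarrow>
     (\<exists>(S :: ('n \<Rightarrow> nat) set) q. finite S \<and> (\<forall>\<alpha>\<in>S. smooth_on V (q \<alpha>)) \<and>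
        (\<forall>x\<in>V. \<forall>y. P x y = (\<Sum>\<alpha>\<in>S. q \<alpha> x * (\<Prod>i\<in>UNIV. (y $ i) ^ \<alpha> i))))"

text \<open>A denominator has to be a nonzero polynomial in \<open>y\<close> for every \<open>x\<close>, but it may have zeros;
  there the quotient expression imposes no condition. Over the reals a polynomial is nonzero iff
  its values are not all zero.\<close>

definition rational_in_fibre :: "(real ^ 'n::finite) set \<Rightarrow> (real ^ 'n \<Rightarrow> real ^ 'n \<Rightarrow> real) \<Rightarrow> bool" where
  "rational_in_fibre D f \<longleftrightarrow>
     (\<forall>x\<^sub>0\<in>D. \<exists>V P Q. open V \<and> x\<^sub>0 \<in> V \<and> V \<subseteq> D \<and> fibre_polynomial V P \<and> fibre_polynomial V Q \<and>
        (\<forall>x\<in>V. \<exists>y. Q x y \<noteq> 0) \<and>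
        (\<forall>x\<in>V. \<forall>y. y \<noteq> 0 \<and> Q x y \<noteq> 0 \<longrightarrow> f x y = P x y / Q x y))"

definition rational_function :: "(real ^ 'n::finite \<Rightarrow> real) \<Rightarrow> bool" where
  "rational_function h \<longleftrightarrow>
     (\<exists>P Q. real_polynomial_function P \<and> real_polynomial_function Q \<and> (\<exists>y. Q y \<noteq> 0) \<and>
        (\<forall>y. y \<noteq> 0 \<and> Q y \<noteq> 0 \<longrightarrow> h y = P y / Q y))"


section \<open>AR-Finsler manifolds\<close>

definition Finsler_metric :: "'a topology \<Rightarrow> ('a, 'n::finite) chart set \<Rightarrow> ('a \<times> ('a, 'n) tangent \<Rightarrow> real) \<Rightarrow> bool" where
  "Finsler_metric M \<A> F \<longleftrightarrow>
     (\<forall>u\<in>tangent_bundle M \<A>. 0 \<le> F u) \<and>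
     smooth_on_slit \<A> F \<and>
     (\<forall>(p, v)\<in>tangent_bundle M \<A>. \<forall>r>0. F (p, \<lambda>c. r *\<^sub>R v c) = r * F (p, v)) \<and>
     (\<forall>c\<in>\<A>. \<forall>x\<in>chart_image c. \<forall>y. y \<noteq> 0 \<longrightarrow> pos_definite (metric (local_rep \<A> c F) x y))"

text \<open>\<open>a c x y\<close> is the matrix \<open>(a\<^sub>i\<^sub>j(x, y))\<close> in the coordinates of the chart \<open>c\<close>.\<close>

definition AR_Finsler_manifold :: "'a topology \<Rightarrow> ('a, 'n::finite) chart set \<Rightarrow>
    ('a \<times> ('a, 'n) tangent \<Rightarrow> real) \<Rightarrow> ('a \<times> ('a, 'n) tangent \<Rightarrow> real) \<Rightarrow>
    (('a, 'n) chart \<Rightarrow> real ^ 'n \<Rightarrow> real ^ 'n \<Rightarrow> real ^ 'n ^ 'n) \<Rightarrow> bool" where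
  "AR_Finsler_manifold M \<A> F \<eta> a \<longleftrightarrow>
     smooth_manifold M \<A> \<and> Finsler_metric M \<A> F \<and>
     (\<forall>u\<in>slit_tangent_bundle M \<A>. 0 \<le> \<eta> u) \<and> smooth_on_slit \<A> \<eta> \<and>
     (\<forall>c\<in>\<A>. \<forall>i j. rational_in_fibre (chart_image c) (\<lambda>x y. a c x y $ i $ j)) \<and>
     (\<forall>c\<in>\<A>. \<forall>x\<in>chart_image c. \<forall>y. y \<noteq> 0 \<longrightarrow>
        transpose (a c x y) = a c x y \<and> pos_definite (a c x y) \<and>
        (\<forall>i j. metric (local_rep \<A> c F) x y $ i $ j = local_rep \<A> c \<eta> x y * a c x y $ i $ j) \<and>
        (\<forall>i j. \<forall>r>0. local_rep \<A> c \<eta> x (r *\<^sub>R y) * a c x (r *\<^sub>R y) $ i $ j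
                    = local_rep \<A> c \<eta> x y * a c x y $ i $ j))"

definition weakly_Landsberg :: "('a, 'n::finite) chart set \<Rightarrow> ('a \<times> ('a, 'n) tangent \<Rightarrow> real) \<Rightarrow> bool" where
  "weakly_Landsberg \<A> F \<longleftrightarrow>
     (\<forall>c\<in>\<A>. \<forall>x\<in>chart_image c. \<forall>y. y \<noteq> 0 \<longrightarrow> (\<forall>k. mean_landsberg (local_rep \<A> c F) k x y = 0))"

definition isotropic_mean_Landsberg :: "('a, 'n::finite) chart set \<Rightarrow> ('a \<times> ('a, 'n) tangent \<Rightarrow> real) \<Rightarrow> bool" where
  "isotropic_mean_Landsberg \<A> F \<longleftrightarrow>
     (\<exists>A. smooth_on_manifold \<A> A \<and>
       (\<forall>c\<in>\<A>. \<forall>x\<in>chart_image c. \<forall>y. y \<noteq> 0 \<longrightarrow> (\<forall>k.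
          mean_landsberg (local_rep \<A> c F) k x y =
          A (chart_inv c x) * local_rep \<A> c F x y * mean_cartan (local_rep \<A> c F) k x y)))"

end

theory Submission
  imports Defs
begin

text \<open>At a fixed \<open>x\<close>, Euler's relation gives \<open>F\<^sup>2 = \<eta> a\<^sub>i\<^sub>j y\<^sup>i y\<^sup>j\<close> and \<open>\<partial>F\<^sup>2/\<partial>y\<^sup>k = 2 \<eta> a\<^sub>i\<^sub>k y\<^sup>i\<close>, so the
  derivatives of \<open>log \<eta>\<close> in \<open>y\<close> are rational in \<open>y\<close>; those in \<open>x\<close> are rational by hypothesis. Hence
  \<open>\<eta>\<close> times a rational function is again of this form after differentiation, the factors \<open>\<eta>\<close> and
  \<open>\<eta>\<^sup>-\<^sup>1\<close> in the contractions with \<open>g\<^sup>i\<^sup>j\<close> cancel, and the spray coefficients, \<open>J\<^sub>k\<close> and \<open>I\<^sub>k\<close> are all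
  rational in \<open>y\<close>. If \<open>J\<^sub>k = A F I\<^sub>k\<close> does not vanish somewhere, then \<open>A \<noteq> 0\<close> and, by continuity, \<open>I\<^sub>k\<close>
  is not the zero rational function, so \<open>F = J\<^sub>k / (A I\<^sub>k)\<close> would be rational.\<close>

section \<open>Rational functions and Zariski-generic points\<close>

text \<open>The filter generated by the nonempty Zariski-open sets with the origin removed.
  Identities between rational functions are stated as \<open>eventually\<close> along it, so that
  finitely many exceptional hypersurfaces are discarded together by \<open>eventually_elim\<close>
  and denominators need not be carried along.\<close>

definition generic :: "'a::real_normed_vector filter" where
  "generic = (INF Q\<in>{Q. real_polynomial_function Q \<and> (\<exists>y. Q y \<noteq> 0)}. principal {y. y \<noteq> 0 \<and> Q y \<noteq> 0})"

text \<open>On a line \<open>Q\<close> becomes a polynomial in one variable, and its value at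
  \<open>t\<^sub>0\<close> shows that some coefficient is nonzero. This reduction to lines replaces
  all multivariate algebra below.\<close>

lemma finite_zeros_on_line:
  fixes Q :: "'a::real_normed_vector \<Rightarrow> real"
  assumes "real_polynomial_function Q" and "Q (y + t\<^sub>0 *\<^sub>R d) \<noteq> 0"
  shows "finite {t. Q (y + t *\<^sub>R d) = 0}"
proof -
  have "polynomial_function (\<lambda>t::real. t *\<^sub>R d)"
    by (intro polynomial_function_bounded_linear bounded_linear_scaleR_left)
  then have "polynomial_function (\<lambda>t::real. y + t *\<^sub>R d)"
    by (intro polynomial_function_add) auto
  then have "real_polynomial_function (\<lambda>t. Q (y + t *\<^sub>R d))"
    using real_polynomial_function_compose[OF _ assms(1), of "\<lambda>t. y + t *\<^sub>R d"] unfolding o_def by blast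
  then have "\<exists>c n. (\<lambda>t. Q (y + t *\<^sub>R d)) = (\<lambda>t. \<Sum>i\<le>n. c i * t ^ i)"
    unfolding real_polynomial_function_iff_sum .
  then obtain c n where "(\<lambda>t. Q (y + t *\<^sub>R d)) = (\<lambda>t. \<Sum>i\<le>n. c i * t ^ i)" by blast
  then have c: "Q (y + t *\<^sub>R d) = (\<Sum>i\<le>n. c i * t ^ i)" for t by (rule fun_cong)
  have "\<exists>i\<le>n. c i \<noteq> 0"
  proof (rule ccontr)
    assume "\<not> (\<exists>i\<le>n. c i \<noteq> 0)"
    then have "(\<Sum>i\<le>n. c i * t\<^sub>0 ^ i) = 0" by (intro sum.neutral) auto
    then show False using assms(2) c by metis
  qed
  then show ?thesis
    unfolding c by (simp add: polyfun_finite_roots)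
qed

text \<open>On the line through \<open>y\<close> and \<open>z\<close> each factor has only finitely
  many zeros, so some point of the line avoids both zero sets. Thus there are no zero
  divisors.\<close>

lemma polynomial_mult_nonzero:
  fixes P Q :: "'a::real_normed_vector \<Rightarrow> real"
  assumes "real_polynomial_function P" "real_polynomial_function Q" "P y \<noteq> 0" "Q z \<noteq> 0"
  shows "\<exists>w. P w * Q w \<noteq> 0"
proof -
  let ?l = "\<lambda>t::real. y + t *\<^sub>R (z - y)"
  have "finite ({t. P (?l t) = 0} \<union> {t. Q (?l t) = 0})"
    using finite_zeros_on_line[OF assms(1), of y 0] finite_zeros_on_line[OF assms(2), of y 1] assms(3,4)
    by simp
  then obtain t where "t \<notin> {t. P (?l t) = 0} \<union> {t. Q (?l t) = 0}"
    using ex_new_if_finite[OF infinite_UNIV_char_0] by blast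
  then have "P (?l t) * Q (?l t) \<noteq> 0" by simp
  then show ?thesis ..
qed

text \<open>The product of two nonzero polynomials is again nonzero, so the generating sets are
  directed and a single polynomial suffices as a witness.\<close>

lemma eventually_generic:
  "eventually R (generic :: 'a::real_normed_vector filter) \<longleftrightarrow>
    (\<exists>Q. real_polynomial_function Q \<and> (\<exists>y. Q y \<noteq> 0) \<and> (\<forall>y. y \<noteq> 0 \<and> Q y \<noteq> 0 \<longrightarrow> R y))"
proof -
  let ?B = "{Q :: 'a \<Rightarrow> real. real_polynomial_function Q \<and> (\<exists>y. Q y \<noteq> 0)}"
  have "(\<lambda>_. 1) \<in> ?B" by auto
  then have "?B \<noteq> {}" by blast
  moreover have "\<exists>Q\<in>?B. principal {y. y \<noteq> 0 \<and> Q y \<noteq> 0} \<le>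
      inf (principal {y. y \<noteq> 0 \<and> Q1 y \<noteq> 0}) (principal {y. y \<noteq> 0 \<and> Q2 y \<noteq> 0})"
    if "Q1 \<in> ?B" "Q2 \<in> ?B" for Q1 Q2
  proof (rule bexI[of _ "\<lambda>y. Q1 y * Q2 y"])
    obtain y z where "Q1 y \<noteq> 0" "Q2 z \<noteq> 0" using \<open>Q1 \<in> ?B\<close> \<open>Q2 \<in> ?B\<close> by blast
    with that have "\<exists>w. Q1 w * Q2 w \<noteq> 0" by (intro polynomial_mult_nonzero) simp_all
    with that show "(\<lambda>y. Q1 y * Q2 y) \<in> ?B"
      by (simp add: real_polynomial_function.intros(4) del: mult_eq_0_iff)
    show "principal {y. y \<noteq> 0 \<and> Q1 y * Q2 y \<noteq> 0} \<le>
        inf (principal {y. y \<noteq> 0 \<and> Q1 y \<noteq> 0}) (principal {y. y \<noteq> 0 \<and> Q2 y \<noteq> 0})"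
      by (simp only: inf_principal principal_le_iff) auto
  qed
  ultimately show ?thesis
    unfolding generic_def by (subst eventually_INF_base) (auto simp: eventually_principal)
qed

lemma eventually_generic_nonzero: "eventually (\<lambda>y. y \<noteq> 0) generic"
  unfolding eventually_generic by (rule exI[of _ "\<lambda>_. 1"]) auto

lemma eventually_generic_polynomial:
  "real_polynomial_function Q \<Longrightarrow> Q z \<noteq> 0 \<Longrightarrow> eventually (\<lambda>y. Q y \<noteq> 0) generic"
  unfolding eventually_generic by blast

text \<open>Zariski-generic sets are dense in the Euclidean topology. Moving from \<open>z\<close>
  towards a point \<open>y\<^sub>0\<close> with \<open>Q y\<^sub>0 \<noteq> 0\<close>, the
  polynomial vanishes for finitely many parameters only, hence for no small
  \<open>t \<noteq> 0\<close>, even if \<open>Q z = 0\<close>. The origin is kept out of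
  \<open>U\<close> because \<open>R\<close> is known only at nonzero points.\<close>

lemma generic_dense:
  assumes "eventually R generic" "open U" "z \<in> U" "0 \<notin> U"
  shows "\<exists>y\<in>U. R y"
proof -
  obtain Q y\<^sub>0 where Q: "real_polynomial_function Q" "Q y\<^sub>0 \<noteq> 0" "\<And>y. y \<noteq> 0 \<Longrightarrow> Q y \<noteq> 0 \<Longrightarrow> R y"
    using assms(1) unfolding eventually_generic by blast
  have fin: "finite {t. Q (z + t *\<^sub>R (y\<^sub>0 - z)) = 0}"
    using finite_zeros_on_line[OF Q(1), of z 1] Q(2) by simp
  have "((\<lambda>t. z + t *\<^sub>R (y\<^sub>0 - z)) \<longlongrightarrow> z + 0 *\<^sub>R (y\<^sub>0 - z)) (at (0::real))"
    by (intro tendsto_intros)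
  from topological_tendstoD[OF this assms(2)] assms(3)
  have "eventually (\<lambda>t::real. z + t *\<^sub>R (y\<^sub>0 - z) \<in> U) (at 0)" by simp
  moreover have "eventually (\<lambda>t::real. t \<notin> {t. Q (z + t *\<^sub>R (y\<^sub>0 - z)) = 0}) (at 0)"
    using islimpt_finite[OF fin, of 0] unfolding islimpt_iff_eventually by blast
  ultimately have "eventually (\<lambda>t::real. z + t *\<^sub>R (y\<^sub>0 - z) \<in> U \<and> Q (z + t *\<^sub>R (y\<^sub>0 - z)) \<noteq> 0) (at 0)"
    by eventually_elim simp
  from eventually_happens[OF this] obtain t where "z + t *\<^sub>R (y\<^sub>0 - z) \<in> U" "Q (z + t *\<^sub>R (y\<^sub>0 - z)) \<noteq> 0"
    by auto
  then show ?thesis using Q(3) assms(4) by metis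
qed

text \<open>The sets that generate the filter are open in the Euclidean sense. A generic identity
  therefore holds near generic points and may be differentiated there.\<close>

lemma eventually_generic_nhds:
  assumes "eventually R generic"
  shows "eventually (\<lambda>y. eventually R (nhds y)) generic"
proof -
  obtain Q y\<^sub>0 where Q: "real_polynomial_function Q" "Q y\<^sub>0 \<noteq> 0" "\<And>y. y \<noteq> 0 \<Longrightarrow> Q y \<noteq> 0 \<Longrightarrow> R y"
    using assms unfolding eventually_generic by blast
  have "continuous_on UNIV Q"
    using Q(1) continuous_on_polymonial_function real_polynomial_function_eq by blast
  then have "open {y. Q y \<noteq> 0}"
    by (intro open_Collect_neq) auto
  moreover have "open {y::'a. y \<noteq> 0}" by (intro open_Collect_neq) auto
  ultimately have "open ({y. Q y \<noteq> 0} \<inter> {y. y \<noteq> 0})" by blast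
  then have "eventually R (nhds y)" if "y \<noteq> 0" "Q y \<noteq> 0" for y
    unfolding eventually_nhds using that Q(3) by (intro exI[of _ "{y. Q y \<noteq> 0} \<inter> {y. y \<noteq> 0}"]) auto
  then show ?thesis unfolding eventually_generic using Q by blast
qed

section \<open>Closure of the rational functions under the field operations\<close>

text \<open>The polynomial \<open>R\<close> that cuts out the exceptional set is absorbed by passing
  from \<open>P / Q\<close> to \<open>(P * R) / (Q * R)\<close>: its zeros become zeros of the
  denominator, where \<open>rational_function\<close> imposes no condition.\<close>

lemma rational_function_generic:
  "rational_function h \<longleftrightarrow> (\<exists>P Q. real_polynomial_function P \<and> real_polynomial_function Q \<and>
     (\<exists>y. Q y \<noteq> 0) \<and> (\<forall>\<^sub>F y in generic. h y = P y / Q y))"  (is "?l \<longleftrightarrow> ?r")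
proof
  assume ?l then show ?r
    unfolding rational_function_def eventually_generic by blast
next
  assume ?r
  then obtain P Q R where *: "real_polynomial_function P" "real_polynomial_function Q" "real_polynomial_function R"
    "\<exists>y. Q y \<noteq> 0" "\<exists>y. R y \<noteq> 0" "\<forall>y. y \<noteq> 0 \<and> R y \<noteq> 0 \<longrightarrow> h y = P y / Q y"
    unfolding eventually_generic by blast
  show ?l
    unfolding rational_function_def
  proof (rule exI[of _ "\<lambda>y. P y * R y"], rule exI[of _ "\<lambda>y. Q y * R y"], intro conjI)
    show "\<exists>y. Q y * R y \<noteq> 0" using * polynomial_mult_nonzero[of Q R] by blast
    show "\<forall>y. y \<noteq> 0 \<and> Q y * R y \<noteq> 0 \<longrightarrow> h y = (P y * R y) / (Q y * R y)"
      using * by auto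
  qed (use * in auto)
qed

lemma rational_functionI:
  "\<lbrakk>real_polynomial_function P; real_polynomial_function Q; \<exists>y. Q y \<noteq> 0;
    \<forall>\<^sub>F y in generic. h y = P y / Q y\<rbrakk> \<Longrightarrow> rational_function h"
  unfolding rational_function_generic by blast

lemma rational_functionE:
  assumes "rational_function h"
  obtains P Q where "real_polynomial_function P" "real_polynomial_function Q" "\<exists>y. Q y \<noteq> 0"
    "\<forall>\<^sub>F y in generic. h y = P y / Q y"
  using assms unfolding rational_function_generic by blast

lemma rational_function_cong:
  assumes "rational_function g" "\<forall>\<^sub>F y in generic. f y = g y"
  shows "rational_function f"
proof -
  obtain P Q where *: "real_polynomial_function P" "real_polynomial_function Q" "\<exists>y. Q y \<noteq> 0"
    "\<forall>\<^sub>F y in generic. g y = P y / Q y"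
    using assms(1) by (elim rational_functionE)
  from *(4) assms(2) have "\<forall>\<^sub>F y in generic. f y = P y / Q y"
    by eventually_elim simp
  with *(1-3) show ?thesis by (rule rational_functionI)
qed

lemma rational_function_polynomial: "real_polynomial_function P \<Longrightarrow> rational_function P"
  by (rule rational_functionI[of P "\<lambda>_. 1"]) auto

lemma rational_function_const: "rational_function (\<lambda>_. c)"
  by (rule rational_function_polynomial) auto

lemma rational_function_component: "rational_function (\<lambda>y. y $ i)"
  by (rule rational_function_polynomial) (simp add: bounded_linear_vec_nth real_polynomial_function.intros(1))

lemma rational_function_add:
  assumes "rational_function f" "rational_function g"
  shows "rational_function (\<lambda>y. f y + g y)"
proof -
  obtain P Q P' Q' where *: "real_polynomial_function P" "real_polynomial_function Q" "\<exists>y. Q y \<noteq> 0"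
    "\<forall>\<^sub>F y in generic. f y = P y / Q y" "real_polynomial_function P'" "real_polynomial_function Q'" "\<exists>y. Q' y \<noteq> 0"
    "\<forall>\<^sub>F y in generic. g y = P' y / Q' y"
    using assms by (elim rational_functionE)
  show ?thesis
  proof (rule rational_functionI)
    show "\<exists>y. Q y * Q' y \<noteq> 0" using * polynomial_mult_nonzero[of Q Q'] by blast
    have "\<forall>\<^sub>F y in generic. Q y \<noteq> 0" "\<forall>\<^sub>F y in generic. Q' y \<noteq> 0"
      using * eventually_generic_polynomial by blast+
    with *(4,8) show "\<forall>\<^sub>F y in generic. f y + g y = (P y * Q' y + P' y * Q y) / (Q y * Q' y)"
      by eventually_elim (simp add: field_simps)
  qed (use * in auto)
qed

lemma rational_function_mult:
  assumes "rational_function f" "rational_function g"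
  shows "rational_function (\<lambda>y. f y * g y)"
proof -
  obtain P Q P' Q' where *: "real_polynomial_function P" "real_polynomial_function Q" "\<exists>y. Q y \<noteq> 0"
    "\<forall>\<^sub>F y in generic. f y = P y / Q y" "real_polynomial_function P'" "real_polynomial_function Q'" "\<exists>y. Q' y \<noteq> 0"
    "\<forall>\<^sub>F y in generic. g y = P' y / Q' y"
    using assms by (elim rational_functionE)
  show ?thesis
  proof (rule rational_functionI)
    show "\<exists>y. Q y * Q' y \<noteq> 0" using * polynomial_mult_nonzero[of Q Q'] by blast
    from *(4,8) show "\<forall>\<^sub>F y in generic. f y * g y = (P y * P' y) / (Q y * Q' y)"
      by eventually_elim (simp add: field_simps)
  qed (use * in auto)
qed

text \<open>For \<open>f = 0\<close> this relies on \<open>inverse 0 = 0\<close>.\<close>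

lemma rational_function_inverse:
  assumes "rational_function f"
  shows "rational_function (\<lambda>y. inverse (f y))"
proof -
  obtain P Q where *: "real_polynomial_function P" "real_polynomial_function Q" "\<exists>y. Q y \<noteq> 0"
    "\<forall>\<^sub>F y in generic. f y = P y / Q y"
    using assms by (elim rational_functionE)
  show ?thesis
  proof (cases "\<exists>y. P y \<noteq> 0")
    case True
    have "\<forall>\<^sub>F y in generic. inverse (f y) = Q y / P y"
      using *(4) by eventually_elim simp
    then show ?thesis
      by (rule rational_functionI[OF *(2,1) True])
  next
    case False
    have "\<forall>\<^sub>F y in generic. inverse (f y) = 0"
      using *(4) by eventually_elim (use False in simp)
    then show ?thesis
      by (rule rational_function_cong[OF rational_function_const])
  qed
qed

lemma rational_function_divide:
  "rational_function f \<Longrightarrow> rational_function g \<Longrightarrow> rational_function (\<lambda>y. f y / g y)"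
  unfolding divide_inverse by (intro rational_function_mult rational_function_inverse)

lemma rational_function_diff:
  "rational_function f \<Longrightarrow> rational_function g \<Longrightarrow> rational_function (\<lambda>y. f y - g y)"
  using rational_function_add[of f "\<lambda>y. -1 * g y"] rational_function_mult[OF rational_function_const[of "-1"], of g]
  by simp

lemma rational_function_sum:
  "(\<And>i. i \<in> I \<Longrightarrow> rational_function (f i)) \<Longrightarrow> rational_function (\<lambda>y. \<Sum>i\<in>I. f i y)"
  by (induction I rule: infinite_finite_induct) (auto intro: rational_function_const rational_function_add)

lemma rational_function_prod:
  "(\<And>i. i \<in> I \<Longrightarrow> rational_function (f i)) \<Longrightarrow> rational_function (\<lambda>y. \<Prod>i\<in>I. f i y)"
  by (induction I rule: infinite_finite_induct) (auto intro: rational_function_const rational_function_mult)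

lemmas rational_function_intros =
  rational_function_const rational_function_component rational_function_add rational_function_mult
  rational_function_divide rational_function_diff rational_function_sum rational_function_prod

lemma rational_function_det:
  "(\<And>i j. rational_function (\<lambda>y. B y $ i $ j)) \<Longrightarrow> rational_function (\<lambda>y. det (B y))"
  unfolding det_def by (intro rational_function_intros)

section \<open>Directional derivatives of rational functions\<close>

text \<open>Induction on the construction of polynomial functions. One \<open>P'\<close> serves all
  base points \<open>y\<close>, which is what keeps the derivative inside the class.\<close>

lemma polynomial_has_line_derivative:
  "real_polynomial_function P \<Longrightarrow>
    \<exists>P'. real_polynomial_function P' \<and> (\<forall>y. ((\<lambda>t. P (y + t *\<^sub>R v)) has_real_derivative P' y) (at 0))"
proof (induction rule: real_polynomial_function.induct)
  case (linear f)
  interpret bounded_linear f by fact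
  have "((\<lambda>t. f (y + t *\<^sub>R v)) has_real_derivative f v) (at 0)" for y
    unfolding add scaleR by (auto intro!: derivative_eq_intros)
  then show ?case by (intro exI[of _ "\<lambda>_. f v"]) auto
next
  case (const c)
  then show ?case by (intro exI[of _ "\<lambda>_. 0"]) auto
next
  case (add f g)
  then obtain f' g' where "real_polynomial_function f'" "real_polynomial_function g'"
    "\<And>y. ((\<lambda>t. f (y + t *\<^sub>R v)) has_real_derivative f' y) (at 0)"
    "\<And>y. ((\<lambda>t. g (y + t *\<^sub>R v)) has_real_derivative g' y) (at 0)"
    by blast
  then show ?case
    by (intro exI[of _ "\<lambda>y. f' y + g' y"]) (auto intro!: derivative_eq_intros)
next
  case (mult f g)
  then obtain f' g' where *: "real_polynomial_function f'" "real_polynomial_function g'"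
    "\<And>y. ((\<lambda>t. f (y + t *\<^sub>R v)) has_real_derivative f' y) (at 0)"
    "\<And>y. ((\<lambda>t. g (y + t *\<^sub>R v)) has_real_derivative g' y) (at 0)"
    by blast
  have "((\<lambda>t. f (y + t *\<^sub>R v) * g (y + t *\<^sub>R v)) has_real_derivative f' y * g y + g' y * f y) (at 0)" for y
    using DERIV_mult[OF *(3,4), of y y] by simp
  with mult * show ?case
    by (intro exI[of _ "\<lambda>y. f' y * g y + g' y * f y"]) auto
qed

lemma eventually_nhds_line:
  fixes y v :: "'a::real_normed_vector"
  assumes "eventually R (nhds y)"
  shows "\<forall>\<^sub>F t in nhds (0::real). R (y + t *\<^sub>R v)"
proof -
  have "((\<lambda>t::real. y + t *\<^sub>R v) \<longlongrightarrow> y + 0 *\<^sub>R v) (nhds 0)"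
    by (intro tendsto_intros filterlim_ident)
  then show ?thesis
    using assms by (simp add: filterlim_iff)
qed

lemma has_real_derivative_eventually_eq:
  assumes "(g has_real_derivative D) (at x)" "\<forall>\<^sub>F t in nhds x. f t = g t"
  shows "(f has_real_derivative D) (at x)"
  using iffD2[OF DERIV_cong_ev[OF refl assms(2) refl] assms(1)] .

text \<open>The quotient rule. Differentiability is recorded separately because \<open>deriv\<close>
  has a value even where no derivative exists, and later product rules need a genuine
  derivative.\<close>

lemma rational_function_line_derivative:
  assumes "rational_function h"
  shows "rational_function (\<lambda>y. deriv (\<lambda>t. h (y + t *\<^sub>R v)) 0)"
    and "\<forall>\<^sub>F y in generic. (\<lambda>t. h (y + t *\<^sub>R v)) differentiable at 0"
proof -
  obtain P Q where *: "real_polynomial_function P" "real_polynomial_function Q" "\<exists>y. Q y \<noteq> 0"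
    "\<forall>\<^sub>F y in generic. h y = P y / Q y"
    using assms by (elim rational_functionE)
  obtain P' Q' where d: "real_polynomial_function P'" "real_polynomial_function Q'"
    "\<And>y. ((\<lambda>t. P (y + t *\<^sub>R v)) has_real_derivative P' y) (at 0)"
    "\<And>y. ((\<lambda>t. Q (y + t *\<^sub>R v)) has_real_derivative Q' y) (at 0)"
    using polynomial_has_line_derivative *(1,2) by metis
  have "\<forall>\<^sub>F y in generic. Q y \<noteq> 0"
    using * eventually_generic_polynomial by blast
  \<comment> \<open>The equation \<open>h = P / Q\<close> is needed on a neighbourhood of
    \<open>y\<close>, not only at \<open>y\<close>, to transfer the derivative.\<close>
  with eventually_generic_nhds[OF *(4)]
  have D: "\<forall>\<^sub>F y in generic. ((\<lambda>t. h (y + t *\<^sub>R v)) has_real_derivative (P' y * Q y - P y * Q' y) / (Q y * Q y)) (at 0)"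
  proof eventually_elim
    case (elim y)
    have "((\<lambda>t. P (y + t *\<^sub>R v) / Q (y + t *\<^sub>R v)) has_real_derivative
        (P' y * Q y - P y * Q' y) / (Q y * Q y)) (at 0)"
      using DERIV_divide[OF d(3,4), of y y] elim by simp
    then show ?case
      by (rule has_real_derivative_eventually_eq) (rule eventually_nhds_line[OF elim(1)])
  qed
  show "\<forall>\<^sub>F y in generic. (\<lambda>t. h (y + t *\<^sub>R v)) differentiable at 0"
    using D by eventually_elim (auto simp: real_differentiable_def)
  have "rational_function (\<lambda>y. (P' y * Q y - P y * Q' y) / (Q y * Q y))"
    using * d by (intro rational_function_intros rational_function_polynomial)
  moreover have "\<forall>\<^sub>F y in generic. deriv (\<lambda>t. h (y + t *\<^sub>R v)) 0 = (P' y * Q y - P y * Q' y) / (Q y * Q y)"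
    using D by eventually_elim (rule DERIV_imp_deriv)
  ultimately show "rational_function (\<lambda>y. deriv (\<lambda>t. h (y + t *\<^sub>R v)) 0)"
    by (rule rational_function_cong)
qed

section \<open>Inverse matrices\<close>

text \<open>Column \<open>j\<close> of the inverse solves \<open>B *v v = axis j 1\<close>, so
  Cramer's rule applies. The quotient of determinants gives both the rationality and the continuity
  of the inverse metric.\<close>

lemma matrix_inv_cramer:
  fixes B :: "real ^ 'n::finite ^ 'n"
  assumes "det B \<noteq> 0"
  shows "matrix_inv B $ i $ j = det (\<chi> k l. if l = i then axis j 1 $ k else B $ k $ l) / det B"
proof -
  have "invertible B" using assms invertible_det_nz by blast
  then have "B ** matrix_inv B = mat 1"
    unfolding invertible_def matrix_inv_def by (metis (mono_tags, lifting) someI_ex)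
  then have "B *v (matrix_inv B *v axis j 1) = axis j 1"
    by (simp add: matrix_vector_mul_assoc)
  then have "matrix_inv B *v axis j 1 = (\<chi> k. det (\<chi> i l. if l = k then axis j 1 $ i else B $ i $ l) / det B)"
    using cramer[OF assms] by blast
  moreover have "(matrix_inv B *v axis j 1) $ i = matrix_inv B $ i $ j"
    by (simp add: matrix_vector_mult_basis column_def)
  ultimately show ?thesis by simp
qed

text \<open>Uniqueness of inverses. It is used to move the factor \<open>\<eta>\<close> out of the
  inverse metric.\<close>

lemma matrix_inv_scaleR:
  fixes B :: "real ^ 'n::finite ^ 'n"
  assumes "det B \<noteq> 0" "c \<noteq> 0"
  shows "matrix_inv (c *\<^sub>R B) = inverse c *\<^sub>R matrix_inv B"
proof -
  have inv: "invertible B" using assms invertible_det_nz by blast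
  then have B: "B ** matrix_inv B = mat 1" "matrix_inv B ** B = mat 1"
    unfolding invertible_def matrix_inv_def by (metis (mono_tags, lifting) someI_ex)+
  have 1: "(c *\<^sub>R B) ** (inverse c *\<^sub>R matrix_inv B) = mat 1" "(inverse c *\<^sub>R matrix_inv B) ** (c *\<^sub>R B) = mat 1"
    using assms(2) B by (simp_all add: matrix_scalar_ac flip: scalar_matrix_assoc)
  then have "invertible (c *\<^sub>R B)" unfolding invertible_def by blast
  then have "matrix_inv (c *\<^sub>R B) ** (c *\<^sub>R B) = mat 1"
    unfolding invertible_def matrix_inv_def by (metis (mono_tags, lifting) someI_ex)
  then show ?thesis
    using 1 by (metis matrix_mul_assoc matrix_mul_lid matrix_mul_rid)
qed

lemma pos_definite_det:
  assumes "pos_definite B" shows "det B \<noteq> 0"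
proof -
  have "B *v v = 0 \<Longrightarrow> v = 0" for v
    using assms unfolding pos_definite_def by (metis inner_zero_right less_irrefl)
  then show ?thesis
    using matrix_left_invertible_ker[of B] invertible_left_inverse invertible_det_nz by blast
qed

lemma rational_function_matrix_inv:
  assumes "\<And>i j. rational_function (\<lambda>y. B y $ i $ j)" "\<forall>\<^sub>F y in generic. det (B y) \<noteq> 0"
  shows "rational_function (\<lambda>y. matrix_inv (B y) $ i $ j)"
proof (rule rational_function_cong)
  have "rational_function (\<lambda>y. if l = i then axis j 1 $ k else B y $ k $ l)" for k l
    by (cases "l = i") (simp_all add: assms(1) rational_function_const)
  then show "rational_function (\<lambda>y. det (\<chi> k l. if l = i then axis j 1 $ k else B y $ k $ l) / det (B y))"
    by (intro rational_function_divide rational_function_det assms(1)) simp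
  show "\<forall>\<^sub>F y in generic. matrix_inv (B y) $ i $ j = det (\<chi> k l. if l = i then axis j 1 $ k else B y $ k $ l) / det (B y)"
    using assms(2) by eventually_elim (rule matrix_inv_cramer)
qed

section \<open>Smooth functions and partial derivatives\<close>

text \<open>Since \<open>S\<close> is open, agreement on \<open>S\<close> already forces the Frechet
  derivatives to agree at each point of \<open>S\<close>.\<close>

lemma Ck_on_cong:
  assumes "open S"
  shows "(\<And>x. x \<in> S \<Longrightarrow> f x = g x) \<Longrightarrow> Ck_on k f S \<Longrightarrow> Ck_on k g S"
proof (induction k arbitrary: f g)
  case 0
  then show ?case using continuous_on_cong[of S S f g] by simp
next
  case (Suc k)
  have D: "(g has_derivative frechet_derivative f (at x)) (at x)" if "x \<in> S" for x
  proof (rule has_derivative_transform_within_open[OF _ assms that])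
    show "(f has_derivative frechet_derivative f (at x)) (at x)"
      using Suc.prems(2) that frechet_derivative_works by auto
  qed (use Suc.prems in auto)
  have "Ck_on k (\<lambda>x. frechet_derivative g (at x) v) S" for v
  proof (rule Suc.IH)
    show "frechet_derivative f (at x) v = frechet_derivative g (at x) v" if "x \<in> S" for x
      using frechet_derivative_at[OF D[OF that]] by simp
    show "Ck_on k (\<lambda>x. frechet_derivative f (at x) v) S" using Suc.prems(2) by simp
  qed
  then show ?case using D by (auto simp: differentiable_def)
qed

lemma Ck_on_Suc_imp: "Ck_on (Suc k) f S \<Longrightarrow> Ck_on k f S"
proof (induction k arbitrary: f)
  case 0
  then show ?case
    by (simp add: continuous_at_imp_continuous_on differentiable_imp_continuous_within)
next
  case (Suc k)
  then show ?case by (metis Ck_on.simps(2))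
qed

lemma Ck_on_const: "Ck_on k (\<lambda>x. c) S"
  by (induction k arbitrary: c) auto

lemma Ck_on_add:
  assumes "open S"
  shows "Ck_on k f S \<Longrightarrow> Ck_on k g S \<Longrightarrow> Ck_on k (\<lambda>x. f x + g x) S"
proof (induction k arbitrary: f g)
  case 0
  then show ?case by (auto intro: continuous_intros)
next
  case (Suc k)
  have d: "f differentiable at x" "g differentiable at x" if "x \<in> S" for x
    using Suc.prems that by auto
  have D: "((\<lambda>x. f x + g x) has_derivative (\<lambda>v. frechet_derivative f (at x) v + frechet_derivative g (at x) v)) (at x)"
    if "x \<in> S" for x
    by (intro has_derivative_add) (use d[OF that] frechet_derivative_works in blast)+
  have "Ck_on k (\<lambda>x. frechet_derivative (\<lambda>x. f x + g x) (at x) v) S" for v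
  proof (rule Ck_on_cong[OF assms])
    show "Ck_on k (\<lambda>x. frechet_derivative f (at x) v + frechet_derivative g (at x) v) S"
      by (rule Suc.IH) (use Suc.prems in auto)
    show "frechet_derivative f (at x) v + frechet_derivative g (at x) v = frechet_derivative (\<lambda>x. f x + g x) (at x) v"
      if "x \<in> S" for x
      using frechet_derivative_at[OF D[OF that]] by metis
  qed
  then show ?case using D by (auto simp: differentiable_def)
qed

text \<open>Induction with the product rule. The undifferentiated factors in the derivative are
  needed only one order lower, which is where \<open>Ck_on_Suc_imp\<close> enters.\<close>

lemma Ck_on_mult:
  fixes f g :: "'a::real_normed_vector \<Rightarrow> real"
  assumes "open S"
  shows "Ck_on k f S \<Longrightarrow> Ck_on k g S \<Longrightarrow> Ck_on k (\<lambda>x. f x * g x) S"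
proof (induction k arbitrary: f g)
  case 0
  then show ?case by (auto intro: continuous_intros)
next
  case (Suc k)
  have d: "f differentiable at x" "g differentiable at x" if "x \<in> S" for x
    using Suc.prems that by auto
  have D: "((\<lambda>x. f x * g x) has_derivative
      (\<lambda>v. f x * frechet_derivative g (at x) v + frechet_derivative f (at x) v * g x)) (at x)"
    if "x \<in> S" for x
    by (intro has_derivative_mult) (use d[OF that] frechet_derivative_works in blast)+
  have "Ck_on k (\<lambda>x. frechet_derivative (\<lambda>x. f x * g x) (at x) v) S" for v
  proof (rule Ck_on_cong[OF assms])
    show "Ck_on k (\<lambda>x. f x * frechet_derivative g (at x) v + frechet_derivative f (at x) v * g x) S"
      using Suc.prems by (intro Ck_on_add[OF assms] Suc.IH) (auto intro: Ck_on_Suc_imp)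
    show "f x * frechet_derivative g (at x) v + frechet_derivative f (at x) v * g x
        = frechet_derivative (\<lambda>x. f x * g x) (at x) v" if "x \<in> S" for x
      using frechet_derivative_at[OF D[OF that]] by metis
  qed
  then show ?case using D by (auto simp: differentiable_def)
qed

lemma smooth_on_mult:
  fixes f g :: "'a::real_normed_vector \<Rightarrow> real"
  shows "open S \<Longrightarrow> smooth_on S f \<Longrightarrow> smooth_on S g \<Longrightarrow> smooth_on S (\<lambda>x. f x * g x)"
  unfolding smooth_on_def by (blast intro: Ck_on_mult)

lemma smooth_on_const: "smooth_on S (\<lambda>_. c)"
  unfolding smooth_on_def by (blast intro: Ck_on_const)

lemma smooth_on_cong:
  "open S \<Longrightarrow> (\<And>x. x \<in> S \<Longrightarrow> f x = g x) \<Longrightarrow> smooth_on S f \<Longrightarrow> smooth_on S g"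
  unfolding smooth_on_def by (blast intro: Ck_on_cong)

lemma smooth_on_differentiable: "smooth_on S f \<Longrightarrow> x \<in> S \<Longrightarrow> f differentiable (at x)"
  unfolding smooth_on_def using Ck_on.simps(2) by blast

lemma smooth_on_continuous_on: "smooth_on S f \<Longrightarrow> continuous_on S f"
  unfolding smooth_on_def using Ck_on.simps(1) by blast

lemma smooth_on_frechet_derivative: "smooth_on S f \<Longrightarrow> smooth_on S (\<lambda>x. frechet_derivative f (at x) v)"
  unfolding smooth_on_def using Ck_on.simps(2) by blast

section \<open>Partial derivatives and Euler's relation\<close>

text \<open>The bridge between the two notions of derivative in use: smoothness is phrased with
  Frechet derivatives, whereas \<open>dx\<close> and \<open>dy\<close> are one-variable derivatives
  along coordinate lines.\<close>

lemma differentiable_line_derivative: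
  fixes h :: "'a::real_normed_vector \<Rightarrow> real"
  assumes "h differentiable (at p)"
  shows "((\<lambda>t. h (p + t *\<^sub>R v)) has_real_derivative frechet_derivative h (at p) v) (at 0)"
proof -
  have "(h has_derivative frechet_derivative h (at p)) (at (p + 0 *\<^sub>R v))"
    using frechet_derivative_works[THEN iffD1, OF assms] by simp
  moreover have "((\<lambda>t::real. p + t *\<^sub>R v) has_derivative (\<lambda>t. t *\<^sub>R v)) (at 0)"
    by (auto intro!: derivative_eq_intros)
  ultimately have "((\<lambda>t. h (p + t *\<^sub>R v)) has_derivative (\<lambda>t. frechet_derivative h (at p) (t *\<^sub>R v))) (at 0)"
    by (rule has_derivative_compose[rotated])
  moreover have "(\<lambda>t. frechet_derivative h (at p) (t *\<^sub>R v)) = (*) (frechet_derivative h (at p) v)"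
    using linear_cmul[OF linear_frechet_derivative[OF assms]] by (auto simp: mult.commute)
  ultimately show ?thesis
    by (simp add: has_field_derivative_def)
qed

lemma smooth_has_dx:
  assumes "smooth_on S (\<lambda>(x, y). f x y)" "(x, y) \<in> S"
  shows "((\<lambda>t. f (x + t *\<^sub>R axis i 1) y) has_real_derivative dx i f x y) (at 0)"
proof -
  have "((\<lambda>t. f (x + t *\<^sub>R axis i 1) y) has_real_derivative
      frechet_derivative (\<lambda>(x, y). f x y) (at (x, y)) (axis i 1, 0)) (at 0)"
    using differentiable_line_derivative[OF smooth_on_differentiable[OF assms], of "(axis i 1, 0)"] by simp
  then show ?thesis unfolding dx_def using DERIV_imp_deriv by metis
qed

lemma smooth_dy_frechet:
  assumes "smooth_on S (\<lambda>(x, y). f x y)" "(x, y) \<in> S"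
  shows "dy i f x y = frechet_derivative (\<lambda>(x, y). f x y) (at (x, y)) (0, axis i 1)"
    and "((\<lambda>t. f x (y + t *\<^sub>R axis i 1)) has_real_derivative dy i f x y) (at 0)"
proof -
  have *: "((\<lambda>t. f x (y + t *\<^sub>R axis i 1)) has_real_derivative
      frechet_derivative (\<lambda>(x, y). f x y) (at (x, y)) (0, axis i 1)) (at 0)"
    using differentiable_line_derivative[OF smooth_on_differentiable[OF assms], of "(0, axis i 1)"] by simp
  then show 1: "dy i f x y = frechet_derivative (\<lambda>(x, y). f x y) (at (x, y)) (0, axis i 1)"
    unfolding dy_def by (rule DERIV_imp_deriv)
  show "((\<lambda>t. f x (y + t *\<^sub>R axis i 1)) has_real_derivative dy i f x y) (at 0)"
    using * unfolding 1 .
qed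

lemmas smooth_has_dy = smooth_dy_frechet(2)

lemma smooth_on_dy:
  assumes "open S" "smooth_on S (\<lambda>(x, y). f x y)"
  shows "smooth_on S (\<lambda>(x, y). dy i f x y)"
proof (rule smooth_on_cong[OF assms(1)])
  show "smooth_on S (\<lambda>p. frechet_derivative (\<lambda>(x, y). f x y) (at p) (0, axis i 1))"
    by (rule smooth_on_frechet_derivative) fact
qed (use smooth_dy_frechet(1)[OF assms(2)] in auto)

lemma smooth_on_slice:
  assumes "smooth_on S (\<lambda>(x, y). f x y)"
  shows "continuous_on {y. (x, y) \<in> S} (f x)"
proof -
  have "continuous_on {y. (x, y) \<in> S} ((\<lambda>(x, y). f x y) \<circ> (\<lambda>y. (x, y)))"
    by (intro continuous_on_compose continuous_intros
          continuous_on_subset[OF smooth_on_continuous_on[OF assms]]) auto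
  then show ?thesis by (simp add: o_def)
qed

lemma smooth_slice_differentiable:
  fixes f :: "'a::real_normed_vector \<Rightarrow> 'b::real_normed_vector \<Rightarrow> real"
  assumes "smooth_on S (\<lambda>(x, y). f x y)" "(x, y) \<in> S"
  shows "f x differentiable (at y)"
proof -
  have "((\<lambda>(x, y). f x y) has_derivative frechet_derivative (\<lambda>(x, y). f x y) (at (x, y))) (at (x, y))"
    using smooth_on_differentiable[OF assms] frechet_derivative_works by blast
  moreover have "((\<lambda>y. (x, y)) has_derivative (\<lambda>v. (0, v))) (at y)"
    by (auto intro!: derivative_eq_intros)
  ultimately have "((\<lambda>y. (\<lambda>(x, y). f x y) (x, y)) has_derivative (\<lambda>v. frechet_derivative (\<lambda>(x, y). f x y) (at (x, y)) (0, v))) (at y)"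
    by (rule has_derivative_compose[rotated])
  then show ?thesis unfolding differentiable_def by auto
qed

text \<open>The function \<open>h (y + t *\<^sub>R y)\<close> is differentiated at
  \<open>t = 0\<close> in two ways: as a directional derivative, and through homogeneity as
  \<open>(1 + t) ^ k * h y\<close>.\<close>

lemma Euler_homogeneous:
  fixes h :: "real ^ 'n::finite \<Rightarrow> real"
  assumes "h differentiable (at y)" "\<And>r. r > 0 \<Longrightarrow> h (r *\<^sub>R y) = r ^ k * h y"
  shows "(\<Sum>i\<in>UNIV. y $ i * deriv (\<lambda>t. h (y + t *\<^sub>R axis i 1)) 0) = k * h y"
proof -
  let ?h' = "frechet_derivative h (at y)"
  have lin: "linear ?h'" by (rule linear_frechet_derivative) fact
  have "((\<lambda>t. h (y + t *\<^sub>R y)) has_real_derivative ?h' y) (at 0)"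
    by (rule differentiable_line_derivative) fact
  moreover have "((\<lambda>t. h (y + t *\<^sub>R y)) has_real_derivative k * h y) (at 0)"
  proof -
    have "((\<lambda>t::real. (1 + t) ^ k * h y) has_real_derivative k * h y) (at 0)"
      by (auto intro!: derivative_eq_intros)
    moreover have "\<forall>\<^sub>F t in nhds (0::real). h (y + t *\<^sub>R y) = (1 + t) ^ k * h y"
    proof -
      \<comment> \<open>Homogeneity is available for positive factors only, hence the restriction to
        \<open>1 + t > 0\<close>.\<close>
      have "\<forall>\<^sub>F t in nhds (0::real). t \<in> {-1<..}"
        by (rule eventually_nhds_in_open) auto
      then show ?thesis
      proof eventually_elim
        case (elim t)
        then show ?case using assms(2)[of "1 + t"] by (simp add: scaleR_left_distrib)
      qed
    qed
    ultimately show ?thesis by (rule has_real_derivative_eventually_eq)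
  qed
  ultimately have "?h' y = k * h y" by (rule DERIV_unique)
  moreover have "?h' y = (\<Sum>i\<in>UNIV. y $ i * ?h' (axis i 1))"
  proof -
    have "?h' y = ?h' (\<Sum>i\<in>UNIV. y $ i *\<^sub>R axis i 1)"
      using basis_expansion[of y] by (simp add: scalar_mult_eq_scaleR)
    also have "\<dots> = (\<Sum>i\<in>UNIV. y $ i * ?h' (axis i 1))"
      by (simp add: linear_sum[OF lin] linear_cmul[OF lin])
    finally show ?thesis .
  qed
  moreover have "deriv (\<lambda>t. h (y + t *\<^sub>R axis i 1)) 0 = ?h' (axis i 1)" for i
    by (rule DERIV_imp_deriv[OF differentiable_line_derivative]) fact
  ultimately show ?thesis by simp
qed

section \<open>Functions rational in the fibre\<close>

lemma fibre_polynomial_real_polynomial: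
  assumes "fibre_polynomial V P" "x \<in> V"
  shows "real_polynomial_function (P x)"
proof -
  obtain S q where *: "finite S" "\<And>x y. x \<in> V \<Longrightarrow> P x y = (\<Sum>\<alpha>\<in>S. q \<alpha> x * (\<Prod>i\<in>UNIV. (y $ i) ^ \<alpha> i))"
    using assms(1) unfolding fibre_polynomial_def by blast
  have "P x = (\<lambda>y. \<Sum>\<alpha>\<in>S. q \<alpha> x * (\<Prod>i\<in>UNIV. (y $ i) ^ \<alpha> i))"
    using *(2)[OF assms(2)] by blast
  moreover have "real_polynomial_function (\<lambda>y. \<Sum>\<alpha>\<in>S. q \<alpha> x * (\<Prod>i\<in>UNIV. (y $ i) ^ \<alpha> i))"
    by (intro real_polynomial_function_sum real_polynomial_function.intros(2-4) real_polynomial_function_prod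
          real_polynomial_function_power real_polynomial_function.intros(1) bounded_linear_vec_nth *(1) finite)
  ultimately show ?thesis by simp
qed

text \<open>A derivative in \<open>x\<close> acts on the smooth coefficients alone and leaves the
  monomials in \<open>y\<close> untouched.\<close>

lemma fibre_polynomial_has_derivative:
  assumes "fibre_polynomial V P" "open V" "x \<in> V"
  shows "\<exists>P'. real_polynomial_function P' \<and> (\<forall>y. ((\<lambda>t. P (x + t *\<^sub>R v) y) has_real_derivative P' y) (at 0))"
proof -
  obtain S q where *: "finite S" "\<And>\<alpha>. \<alpha> \<in> S \<Longrightarrow> smooth_on V (q \<alpha>)"
    "\<And>x y. x \<in> V \<Longrightarrow> P x y = (\<Sum>\<alpha>\<in>S. q \<alpha> x * (\<Prod>i\<in>UNIV. (y $ i) ^ \<alpha> i))"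
    using assms(1) unfolding fibre_polynomial_def by blast
  let ?q' = "\<lambda>\<alpha>. frechet_derivative (q \<alpha>) (at x) v"
  let ?P' = "\<lambda>y. \<Sum>\<alpha>\<in>S. ?q' \<alpha> * (\<Prod>i\<in>UNIV. (y $ i) ^ \<alpha> i)"
  have "real_polynomial_function ?P'"
    by (intro real_polynomial_function_sum real_polynomial_function.intros(2-4) real_polynomial_function_prod
          real_polynomial_function_power real_polynomial_function.intros(1) bounded_linear_vec_nth *(1) finite)
  moreover have "((\<lambda>t. P (x + t *\<^sub>R v) y) has_real_derivative ?P' y) (at 0)" for y
  proof -
    have "((\<lambda>t. q \<alpha> (x + t *\<^sub>R v)) has_real_derivative ?q' \<alpha>) (at 0)" if "\<alpha> \<in> S" for \<alpha>
      by (rule differentiable_line_derivative[OF smooth_on_differentiable[OF *(2)[OF that] assms(3)]])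
    then have "((\<lambda>t. \<Sum>\<alpha>\<in>S. q \<alpha> (x + t *\<^sub>R v) * (\<Prod>i\<in>UNIV. (y $ i) ^ \<alpha> i)) has_real_derivative ?P' y) (at 0)"
      by (intro DERIV_sum DERIV_cmult_right)
    moreover have "\<forall>\<^sub>F t in nhds (0::real). x + t *\<^sub>R v \<in> V"
      by (rule eventually_nhds_line[OF eventually_nhds_in_open[OF assms(2,3)]])
    then have "\<forall>\<^sub>F t in nhds (0::real). P (x + t *\<^sub>R v) y = (\<Sum>\<alpha>\<in>S. q \<alpha> (x + t *\<^sub>R v) * (\<Prod>i\<in>UNIV. (y $ i) ^ \<alpha> i))"
      by eventually_elim (rule *(3))
    ultimately show ?thesis by (rule has_real_derivative_eventually_eq)
  qed
  ultimately have "real_polynomial_function ?P' \<and> (\<forall>y. ((\<lambda>t. P (x + t *\<^sub>R v) y) has_real_derivative ?P' y) (at 0))"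
    by (rule conjI[OF _ allI])
  then show ?thesis by (rule exI[of _ ?P'])
qed

text \<open>The quotient representation holds for all \<open>x\<close> in an open set, so it can be
  differentiated in \<open>x\<close> with \<open>y\<close> fixed; the quotient rule then gives
  polynomials in \<open>y\<close> again. Only here are smooth coefficients, rather than rationality
  at each single \<open>x\<close>, essential.\<close>

lemma rational_in_fibre_at:
  assumes "rational_in_fibre D f" "x \<in> D"
  shows "rational_function (f x)"
    and "rational_function (\<lambda>y. dx k f x y)"
    and "\<forall>\<^sub>F y in generic. ((\<lambda>t. f (x + t *\<^sub>R axis k 1) y) has_real_derivative dx k f x y) (at 0)"
proof -
  obtain V P Q where W: "open V \<and> x \<in> V \<and> V \<subseteq> D \<and> fibre_polynomial V P \<and> fibre_polynomial V Q \<and>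
      (\<forall>x\<in>V. \<exists>y. Q x y \<noteq> 0) \<and> (\<forall>x\<in>V. \<forall>y. y \<noteq> 0 \<and> Q x y \<noteq> 0 \<longrightarrow> f x y = P x y / Q x y)"
    using bspec[OF assms(1)[unfolded rational_in_fibre_def] assms(2)] by (elim exE)
  then have V: "open V" "x \<in> V" "fibre_polynomial V P" "fibre_polynomial V Q" "\<exists>y. Q x y \<noteq> 0"
    by simp_all
  have quot: "f x y = P x y / Q x y" if "x \<in> V" "y \<noteq> 0" "Q x y \<noteq> 0" for x y
    using W that by simp
  have pol: "real_polynomial_function (P x)" "real_polynomial_function (Q x)"
    using fibre_polynomial_real_polynomial[OF V(3,2)] fibre_polynomial_real_polynomial[OF V(4,2)] .
  obtain P' where P': "real_polynomial_function P'"
    "\<And>y. ((\<lambda>t. P (x + t *\<^sub>R axis k 1) y) has_real_derivative P' y) (at 0)"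
    using fibre_polynomial_has_derivative[OF V(3,1,2)] by blast
  obtain Q' where Q': "real_polynomial_function Q'"
    "\<And>y. ((\<lambda>t. Q (x + t *\<^sub>R axis k 1) y) has_real_derivative Q' y) (at 0)"
    using fibre_polynomial_has_derivative[OF V(4,1,2)] by blast
  have nz: "\<forall>\<^sub>F y in generic. Q x y \<noteq> 0"
    using V(5) pol eventually_generic_polynomial by blast
  with eventually_generic_nonzero have "\<forall>\<^sub>F y in generic. f x y = P x y / Q x y"
    by eventually_elim (rule quot[OF V(2)])
  then show "rational_function (f x)"
    by (rule rational_functionI[OF pol V(5)])
  let ?d = "\<lambda>y. (P' y * Q x y - P x y * Q' y) / (Q x y * Q x y)"
  have D: "\<forall>\<^sub>F y in generic. ((\<lambda>t. f (x + t *\<^sub>R axis k 1) y) has_real_derivative ?d y) (at 0)"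
    using nz eventually_generic_nonzero
  proof eventually_elim
    case (elim y)
    have "((\<lambda>t. P (x + t *\<^sub>R axis k 1) y / Q (x + t *\<^sub>R axis k 1) y) has_real_derivative ?d y) (at 0)"
      using DERIV_divide[OF P'(2) Q'(2), of y y] elim by simp
    \<comment> \<open>By continuity the denominator stays nonzero when \<open>x\<close> moves
      slightly, so the quotient formula persists along the coordinate line.\<close>
    moreover have "((\<lambda>t. Q (x + t *\<^sub>R axis k 1) y) \<longlongrightarrow> Q x y) (at 0)"
      using DERIV_isCont[OF Q'(2)] unfolding isCont_def by simp
    then have "((\<lambda>t. Q (x + t *\<^sub>R axis k 1) y) \<longlongrightarrow> Q x y) (nhds 0)"
      unfolding tendsto_nhds_iff by simp
    then have "\<forall>\<^sub>F t in nhds 0. Q (x + t *\<^sub>R axis k 1) y \<noteq> 0"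
      using elim by (intro tendsto_imp_eventually_ne)
    with eventually_nhds_line[OF eventually_nhds_in_open[OF V(1,2)], of "axis k 1"]
    have "\<forall>\<^sub>F t in nhds 0. f (x + t *\<^sub>R axis k 1) y = P (x + t *\<^sub>R axis k 1) y / Q (x + t *\<^sub>R axis k 1) y"
      by eventually_elim (rule quot[OF _ elim(2)])
    ultimately show ?case by (rule has_real_derivative_eventually_eq)
  qed
  then have E: "\<forall>\<^sub>F y in generic. dx k f x y = ?d y"
    unfolding dx_def by eventually_elim (rule DERIV_imp_deriv)
  show "rational_function (\<lambda>y. dx k f x y)"
    by (rule rational_function_cong[OF _ E]) (intro rational_function_intros rational_function_polynomial pol P'(1) Q'(1))
  show "\<forall>\<^sub>F y in generic. ((\<lambda>t. f (x + t *\<^sub>R axis k 1) y) has_real_derivative dx k f x y) (at 0)"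
    using D E by eventually_elim simp
qed

section \<open>Curvatures in an induced chart\<close>

text \<open>The situation in one chart, with \<open>D\<close> as the image of the chart.
  Non-rationality of \<open>F\<close> and the isotropy condition enter only at the end, in
  \<open>isotropic_mean_landsberg_eq_0\<close>.\<close>

locale AR_Finsler_chart =
  fixes D :: "(real ^ 'n::finite) set"
    and F \<eta> :: "real ^ 'n \<Rightarrow> real ^ 'n \<Rightarrow> real"
    and a :: "real ^ 'n \<Rightarrow> real ^ 'n \<Rightarrow> real ^ 'n ^ 'n"
  assumes open_D: "open D"
    and smooth_F: "smooth_on (D \<times> (UNIV - {0})) (\<lambda>(x, y). F x y)"
    and smooth_\<eta>: "smooth_on (D \<times> (UNIV - {0})) (\<lambda>(x, y). \<eta> x y)"
    and F_homogeneous: "x \<in> D \<Longrightarrow> r > 0 \<Longrightarrow> F x (r *\<^sub>R y) = r * F x y"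
    and metric_pos: "x \<in> D \<Longrightarrow> y \<noteq> 0 \<Longrightarrow> pos_definite (metric F x y)"
    and a_pos: "x \<in> D \<Longrightarrow> y \<noteq> 0 \<Longrightarrow> pos_definite (a x y)"
    and metric_eq: "x \<in> D \<Longrightarrow> y \<noteq> 0 \<Longrightarrow> metric F x y = \<eta> x y *\<^sub>R a x y"
    and a_rational: "rational_in_fibre D (\<lambda>x y. a x y $ i $ j)"
    and ln_\<eta>_rational: "rational_in_fibre D (dx i (\<lambda>x y. ln (\<eta> x y)))"
begin

abbreviation slit :: "((real ^ 'n) \<times> (real ^ 'n)) set" where
  "slit \<equiv> D \<times> (UNIV - {0})"

lemma open_slit: "open slit"
  by (intro open_Times open_D open_Diff) auto

text \<open>Both quadratic forms are positive at \<open>y\<close> and differ by the factor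
  \<open>\<eta> x y\<close>. This justifies the divisions by \<open>\<eta>\<close> and the use of
  \<open>ln\<close>.\<close>

lemma \<eta>_pos:
  assumes "x \<in> D" "y \<noteq> 0"
  shows "\<eta> x y > 0"
proof -
  have "0 < y \<bullet> (metric F x y *v y)" "0 < y \<bullet> (a x y *v y)"
    using metric_pos a_pos assms unfolding pos_definite_def by blast+
  then show ?thesis
    by (simp add: metric_eq[OF assms] scaleR_matrix_vector_assoc[symmetric] zero_less_mult_iff)
qed

section \<open>Consequences of Euler's relation for the squared metric\<close>

lemma smooth_Fsq: "smooth_on slit (\<lambda>(x, y). Fsq F x y)"
  using smooth_on_mult[OF open_slit smooth_F smooth_F] by (simp add: Fsq_def power2_eq_square case_prod_unfold)

lemma Fsq_homogeneous: "x \<in> D \<Longrightarrow> r > 0 \<Longrightarrow> Fsq F x (r *\<^sub>R y) = r ^ 2 * Fsq F x y"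
  unfolding Fsq_def by (simp add: F_homogeneous power_mult_distrib)

text \<open>Substituting \<open>t / r\<close> for \<open>t\<close> compares the coordinate line
  through \<open>r *\<^sub>R y\<close> with the one through \<open>y\<close>; of the factor
  \<open>r ^ 2\<close> one power is lost to the chain rule.\<close>

lemma dy_Fsq_homogeneous:
  assumes "x \<in> D" "y \<noteq> 0" "r > 0"
  shows "dy j (Fsq F) x (r *\<^sub>R y) = r * dy j (Fsq F) x y"
proof -
  have "((\<lambda>t. Fsq F x (y + (t / r) *\<^sub>R axis j 1)) has_real_derivative dy j (Fsq F) x y * (1 / r)) (at 0)"
  proof (rule DERIV_chain2[where g = "\<lambda>t. t / r"])
    show "((\<lambda>t. Fsq F x (y + t *\<^sub>R axis j 1)) has_real_derivative dy j (Fsq F) x y) (at (0 / r))"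
      using smooth_has_dy[OF smooth_Fsq] assms by simp
  qed (use assms(3) in \<open>auto intro!: derivative_eq_intros\<close>)
  from DERIV_cmult[OF this, of "r ^ 2"]
  have "((\<lambda>t. r ^ 2 * Fsq F x (y + (t / r) *\<^sub>R axis j 1)) has_real_derivative r * dy j (Fsq F) x y) (at 0)"
    using assms(3) by (simp add: power2_eq_square)
  moreover have "r ^ 2 * Fsq F x (y + (t / r) *\<^sub>R axis j 1) = Fsq F x (r *\<^sub>R y + t *\<^sub>R axis j 1)" for t
    using Fsq_homogeneous[OF assms(1,3), of "y + (t / r) *\<^sub>R axis j 1"] assms(3)
    by (simp add: scaleR_right_distrib)
  ultimately have "((\<lambda>t. Fsq F x (r *\<^sub>R y + t *\<^sub>R axis j 1)) has_real_derivative r * dy j (Fsq F) x y) (at 0)"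
    by simp
  then show ?thesis unfolding dy_def[of j "Fsq F" x "r *\<^sub>R y"] by (rule DERIV_imp_deriv)
qed

text \<open>Euler's relation in degree one for the first derivatives of the squared metric, whose
  own derivatives are twice the metric, that is \<open>2 * \<eta> * a\<close>.\<close>

lemma dy_Fsq:
  assumes "x \<in> D" "y \<noteq> 0"
  shows "dy j (Fsq F) x y = 2 * \<eta> x y * (\<Sum>i\<in>UNIV. y $ i * a x y $ i $ j)"
proof -
  have "(\<Sum>i\<in>UNIV. y $ i * dy i (dy j (Fsq F)) x y) = real 1 * dy j (Fsq F) x y"
    unfolding dy_def[of _ "dy j (Fsq F)"]
  proof (rule Euler_homogeneous)
    show "dy j (Fsq F) x differentiable at y"
      by (rule smooth_slice_differentiable[OF smooth_on_dy[OF open_slit smooth_Fsq]]) (use assms in auto)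
  qed (use dy_Fsq_homogeneous assms in simp)
  moreover have "dy i (dy j (Fsq F)) x y = 2 * \<eta> x y * a x y $ i $ j" for i
    using arg_cong[OF metric_eq[OF assms], of "\<lambda>B. B $ i $ j"] unfolding metric_def by simp
  ultimately show ?thesis
    by (simp add: sum_distrib_left mult_ac)
qed

text \<open>The factor of the squared metric that is rational in \<open>y\<close>; see
  \<open>Fsq_eq\<close>.\<close>

definition energy :: "real ^ 'n \<Rightarrow> real ^ 'n \<Rightarrow> real" where
  "energy x y = (\<Sum>j\<in>UNIV. \<Sum>i\<in>UNIV. y $ j * (y $ i * a x y $ i $ j))"

lemma Fsq_eq:
  assumes "x \<in> D" "y \<noteq> 0"
  shows "Fsq F x y = \<eta> x y * energy x y"
proof -
  have "(\<Sum>j\<in>UNIV. y $ j * dy j (Fsq F) x y) = real 2 * Fsq F x y"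
    unfolding dy_def
  proof (rule Euler_homogeneous)
    show "Fsq F x differentiable at y"
      by (rule smooth_slice_differentiable[OF smooth_Fsq]) (use assms in auto)
  qed (use Fsq_homogeneous assms in simp)
  moreover have "(\<Sum>j\<in>UNIV. y $ j * dy j (Fsq F) x y) = 2 * (\<eta> x y * energy x y)"
    unfolding dy_Fsq[OF assms] energy_def by (simp add: sum_distrib_left mult_ac)
  ultimately show ?thesis by simp
qed

lemma energy_pos:
  assumes "x \<in> D" "y \<noteq> 0"
  shows "energy x y > 0"
proof -
  have "energy x y = y \<bullet> (a x y *v y)"
    unfolding energy_def inner_vec_def matrix_vector_mult_def
    by (subst sum.swap) (simp add: sum_distrib_left mult_ac)
  then show ?thesis using a_pos[OF assms] assms(2) unfolding pos_definite_def by simp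
qed

section \<open>Rationality up to a factor \<eta>\<close>

lemma rational_a: "x \<in> D \<Longrightarrow> rational_function (\<lambda>y. a x y $ i $ j)"
  using rational_in_fibre_at(1)[OF a_rational] .

lemma rational_energy: "x \<in> D \<Longrightarrow> rational_function (energy x)"
  unfolding energy_def by (intro rational_function_intros rational_a)

text \<open>The derivative of the squared metric is computed twice: by the product rule from
  \<open>Fsq_eq\<close>, and by \<open>dy_Fsq\<close>. Both expressions are linear in
  \<open>\<eta>\<close> and its derivative, so the logarithmic derivative can be solved for in terms
  of \<open>a\<close> and \<open>energy\<close>.\<close>

lemma rational_dy_ln_\<eta>:
  assumes "x \<in> D"
  shows "rational_function (\<lambda>y. dy k \<eta> x y / \<eta> x y)"
proof (rule rational_function_cong)
  have diff: "\<forall>\<^sub>F y in generic. (\<lambda>t. energy x (y + t *\<^sub>R axis k 1)) differentiable at 0"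
    and rat: "rational_function (dy k energy x)"
    using rational_function_line_derivative[OF rational_energy[OF assms]] unfolding dy_def by auto
  show "rational_function (\<lambda>y. (2 * (\<Sum>i\<in>UNIV. y $ i * a x y $ i $ k) - dy k energy x y) / energy x y)"
    by (intro rational_function_intros rational_a rational_energy rat assms)
  show "\<forall>\<^sub>F y in generic. dy k \<eta> x y / \<eta> x y =
      (2 * (\<Sum>i\<in>UNIV. y $ i * a x y $ i $ k) - dy k energy x y) / energy x y"
    using diff eventually_generic_nonzero
  proof eventually_elim
    case (elim y)
    have 1: "((\<lambda>t. energy x (y + t *\<^sub>R axis k 1)) has_real_derivative dy k energy x y) (at 0)"
      unfolding dy_def using elim(1) DERIV_deriv_iff_real_differentiable by blast
    have 2: "((\<lambda>t. \<eta> x (y + t *\<^sub>R axis k 1)) has_real_derivative dy k \<eta> x y) (at 0)"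
      using smooth_has_dy[OF smooth_\<eta>] assms elim by simp
    have "((\<lambda>t. Fsq F x (y + t *\<^sub>R axis k 1)) has_real_derivative
        dy k \<eta> x y * energy x y + dy k energy x y * \<eta> x y) (at 0)"
    proof (rule has_real_derivative_eventually_eq)
      show "((\<lambda>t. \<eta> x (y + t *\<^sub>R axis k 1) * energy x (y + t *\<^sub>R axis k 1)) has_real_derivative
        dy k \<eta> x y * energy x y + dy k energy x y * \<eta> x y) (at 0)"
        using DERIV_mult[OF 2 1] by simp
      show "\<forall>\<^sub>F t in nhds 0. Fsq F x (y + t *\<^sub>R axis k 1) = \<eta> x (y + t *\<^sub>R axis k 1) * energy x (y + t *\<^sub>R axis k 1)"
        using eventually_nhds_line[OF t1_space_nhds[OF elim(2)], of "axis k 1"]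
        by eventually_elim (rule Fsq_eq[OF assms])
    qed
    then have "dy k (Fsq F) x y = dy k \<eta> x y * energy x y + dy k energy x y * \<eta> x y"
      unfolding dy_def[of k "Fsq F"] by (rule DERIV_imp_deriv)
    then have "dy k \<eta> x y * energy x y = (2 * (\<Sum>i\<in>UNIV. y $ i * a x y $ i $ k) - dy k energy x y) * \<eta> x y"
      unfolding dy_Fsq[OF assms elim(2)] by (simp add: algebra_simps)
    then show ?case
      using \<eta>_pos[OF assms elim(2)] energy_pos[OF assms elim(2)] by (simp add: frac_eq_eq)
  qed
qed

text \<open>With \<open>f = \<eta> * r\<close> the product rule gives \<open>r\<close> times the
  logarithmic derivative of \<open>\<eta>\<close>, plus the derivative of \<open>r\<close>. Hence
  \<open>\<eta>\<close> times a rational function keeps this form under every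
  \<open>dy k\<close>.\<close>

lemma rational_dy_over_\<eta>:
  assumes "x \<in> D" "rational_function (\<lambda>y. f x y / \<eta> x y)"
  shows "rational_function (\<lambda>y. dy k f x y / \<eta> x y)"
proof (rule rational_function_cong)
  define r where "r = (\<lambda>y. f x y / \<eta> x y)"
  let ?r' = "\<lambda>y. deriv (\<lambda>t. r (y + t *\<^sub>R axis k 1)) 0"
  have rat: "rational_function r" using assms(2) unfolding r_def .
  note dr = rational_function_line_derivative[OF rat, of "axis k 1"]
  show "rational_function (\<lambda>y. dy k \<eta> x y / \<eta> x y * r y + ?r' y)"
    by (intro rational_function_intros rational_dy_ln_\<eta> assms(1) rat dr(1))
  show "\<forall>\<^sub>F y in generic. dy k f x y / \<eta> x y = dy k \<eta> x y / \<eta> x y * r y + ?r' y"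
    using dr(2) eventually_generic_nonzero
  proof eventually_elim
    case (elim y)
    have 1: "((\<lambda>t. r (y + t *\<^sub>R axis k 1)) has_real_derivative ?r' y) (at 0)"
      using elim(1) DERIV_deriv_iff_real_differentiable by blast
    have 2: "((\<lambda>t. \<eta> x (y + t *\<^sub>R axis k 1)) has_real_derivative dy k \<eta> x y) (at 0)"
      using smooth_has_dy[OF smooth_\<eta>] assms elim by simp
    have "((\<lambda>t. f x (y + t *\<^sub>R axis k 1)) has_real_derivative
        dy k \<eta> x y * r y + ?r' y * \<eta> x y) (at 0)"
    proof (rule has_real_derivative_eventually_eq)
      show "((\<lambda>t. \<eta> x (y + t *\<^sub>R axis k 1) * r (y + t *\<^sub>R axis k 1)) has_real_derivative
        dy k \<eta> x y * r y + ?r' y * \<eta> x y) (at 0)"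
        using DERIV_mult[OF 2 1] by simp
      show "\<forall>\<^sub>F t in nhds 0. f x (y + t *\<^sub>R axis k 1) = \<eta> x (y + t *\<^sub>R axis k 1) * r (y + t *\<^sub>R axis k 1)"
        using eventually_nhds_line[OF t1_space_nhds[OF elim(2)], of "axis k 1"]
      proof eventually_elim
        case (elim t)
        then show ?case unfolding r_def using \<eta>_pos[OF assms(1) elim] by simp
      qed
    qed
    then have "dy k f x y = dy k \<eta> x y * r y + ?r' y * \<eta> x y"
      unfolding dy_def[of k f] by (rule DERIV_imp_deriv)
    then show ?case
      using \<eta>_pos[OF assms(1) elim(2)] by (simp add: add_divide_distrib)
  qed
qed

text \<open>The product rule for \<open>\<eta> * energy\<close> in the direction of
  \<open>x\<close>. The logarithmic derivative of \<open>\<eta>\<close> is now rational by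
  assumption, and that of \<open>energy\<close> only involves the entries of
  \<open>a\<close>.\<close>

lemma rational_dx_Fsq:
  assumes "x \<in> D"
  shows "rational_function (\<lambda>y. dx k (Fsq F) x y / \<eta> x y)"
proof (rule rational_function_cong)
  let ?e = "\<lambda>y. \<Sum>j\<in>UNIV. \<Sum>i\<in>UNIV. y $ j * (y $ i * dx k (\<lambda>x y. a x y $ i $ j) x y)"
  show "rational_function (\<lambda>y. dx k (\<lambda>x y. ln (\<eta> x y)) x y * energy x y + ?e y)"
    by (intro rational_function_intros rational_energy rational_in_fibre_at(2)[OF a_rational]
        rational_in_fibre_at(1)[OF ln_\<eta>_rational] assms)
  \<comment> \<open>The index type is finite, so one generic set works for all entries at
    once.\<close>
  have "\<forall>\<^sub>F y in generic. \<forall>i j. ((\<lambda>t. a (x + t *\<^sub>R axis k 1) y $ i $ j) has_real_derivative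
      dx k (\<lambda>x y. a x y $ i $ j) x y) (at 0)"
    by (intro eventually_all_finite rational_in_fibre_at(3)[OF a_rational assms])
  with eventually_generic_nonzero
  show "\<forall>\<^sub>F y in generic. dx k (Fsq F) x y / \<eta> x y = dx k (\<lambda>x y. ln (\<eta> x y)) x y * energy x y + ?e y"
  proof eventually_elim
    case (elim y)
    have pos: "\<eta> x y > 0" by (rule \<eta>_pos[OF assms elim(1)])
    have 1: "((\<lambda>t. energy (x + t *\<^sub>R axis k 1) y) has_real_derivative ?e y) (at 0)"
      unfolding energy_def using elim(2) by (intro DERIV_sum DERIV_cmult) blast
    have 2: "((\<lambda>t. \<eta> (x + t *\<^sub>R axis k 1) y) has_real_derivative dx k \<eta> x y) (at 0)"
      using smooth_has_dx[OF smooth_\<eta>] assms elim by simp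
    have "((\<lambda>t. ln (\<eta> (x + t *\<^sub>R axis k 1) y)) has_real_derivative dx k \<eta> x y / \<eta> x y) (at 0)"
      using DERIV_chain2[OF DERIV_ln 2] pos by (simp add: field_simps)
    then have 3: "dx k (\<lambda>x y. ln (\<eta> x y)) x y = dx k \<eta> x y / \<eta> x y"
      unfolding dx_def[of k "\<lambda>x y. ln (\<eta> x y)"] by (rule DERIV_imp_deriv)
    have "((\<lambda>t. Fsq F (x + t *\<^sub>R axis k 1) y) has_real_derivative
        dx k \<eta> x y * energy x y + ?e y * \<eta> x y) (at 0)"
    proof (rule has_real_derivative_eventually_eq)
      show "((\<lambda>t. \<eta> (x + t *\<^sub>R axis k 1) y * energy (x + t *\<^sub>R axis k 1) y) has_real_derivative
        dx k \<eta> x y * energy x y + ?e y * \<eta> x y) (at 0)"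
        using DERIV_mult[OF 2 1] by simp
      show "\<forall>\<^sub>F t in nhds 0. Fsq F (x + t *\<^sub>R axis k 1) y = \<eta> (x + t *\<^sub>R axis k 1) y * energy (x + t *\<^sub>R axis k 1) y"
        using eventually_nhds_line[OF eventually_nhds_in_open[OF open_D assms], of "axis k 1"]
        by eventually_elim (rule Fsq_eq[OF _ elim(1)])
    qed
    then have "dx k (Fsq F) x y = dx k \<eta> x y * energy x y + ?e y * \<eta> x y"
      unfolding dx_def[of k "Fsq F"] by (rule DERIV_imp_deriv)
    then show ?case
      using pos by (simp add: 3 add_divide_distrib)
  qed
qed

lemma rational_metric:
  assumes "x \<in> D"
  shows "rational_function (\<lambda>y. metric F x y $ i $ j / \<eta> x y)"
proof (rule rational_function_cong[OF rational_a[OF assms]])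
  show "\<forall>\<^sub>F y in generic. metric F x y $ i $ j / \<eta> x y = a x y $ i $ j"
    using eventually_generic_nonzero
    by eventually_elim (simp add: metric_eq[OF assms] less_imp_neq[OF \<eta>_pos[OF assms], symmetric])
qed

lemma rational_metric_inv:
  assumes "x \<in> D"
  shows "rational_function (\<lambda>y. metric_inv F x y $ i $ j * \<eta> x y)"
proof (rule rational_function_cong)
  show "rational_function (\<lambda>y. matrix_inv (a x y) $ i $ j)"
  proof (rule rational_function_matrix_inv[OF rational_a[OF assms]])
    show "\<forall>\<^sub>F y in generic. det (a x y) \<noteq> 0"
      using eventually_generic_nonzero by eventually_elim (rule pos_definite_det[OF a_pos[OF assms]])
  qed
  show "\<forall>\<^sub>F y in generic. metric_inv F x y $ i $ j * \<eta> x y = matrix_inv (a x y) $ i $ j"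
    using eventually_generic_nonzero
  proof eventually_elim
    case (elim y)
    then show ?case
      using \<eta>_pos[OF assms elim] pos_definite_det[OF a_pos[OF assms elim]]
      by (simp add: metric_inv_def metric_eq[OF assms] matrix_inv_scaleR)
  qed
qed

text \<open>The inverse metric carries the factor \<open>1 / \<eta>\<close>, which cancels the
  factor \<open>\<eta>\<close> of \<open>f\<close>.\<close>

lemma rational_contraction:
  assumes "x \<in> D" "rational_function (\<lambda>y. f y / \<eta> x y)"
  shows "rational_function (\<lambda>y. metric_inv F x y $ i $ j * f y)"
proof (rule rational_function_cong[OF rational_function_mult[OF rational_metric_inv[OF assms(1)] assms(2)]])
  show "\<forall>\<^sub>F y in generic. metric_inv F x y $ i $ j * f y = metric_inv F x y $ i $ j * \<eta> x y * (f y / \<eta> x y)"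
    using eventually_generic_nonzero
    by eventually_elim (simp add: less_imp_neq[OF \<eta>_pos[OF assms(1)], symmetric])
qed

section \<open>Rationality of the spray and of the mean curvatures\<close>

text \<open>Both terms in the bracket are \<open>\<eta>\<close> times a rational function, by
  \<open>rational_dx_Fsq\<close> and one further \<open>dy\<close>; contraction with the inverse
  metric removes the factor.\<close>

lemma rational_spray:
  assumes "x \<in> D"
  shows "rational_function (spray F i x)"
  unfolding spray_def
  by (intro rational_function_const rational_function_mult rational_function_sum rational_contraction[OF assms])
     (simp only: diff_divide_distrib sum_divide_distrib times_divide_eq_right[symmetric],
      intro rational_function_intros rational_dx_Fsq rational_dy_over_\<eta> assms)

lemma rational_dy: "rational_function (f x) \<Longrightarrow> rational_function (dy k f x)"
  unfolding dy_def by (rule rational_function_line_derivative(1))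

text \<open>The Berwald curvature is a fibre derivative of the rational spray. Lowering an index
  with the metric brings in one factor \<open>\<eta>\<close>, and the trace with the inverse metric
  takes it out again.\<close>

lemma rational_mean_landsberg:
  assumes "x \<in> D"
  shows "rational_function (mean_landsberg F k x)"
proof -
  have "rational_function (berwald F s i j k x)" for s i j k
    unfolding berwald_def by (intro rational_dy rational_spray assms)
  then have "rational_function (\<lambda>y. 1 / 2 * (\<Sum>m\<in>UNIV. \<Sum>s\<in>UNIV.
      y $ m * (metric F x y $ m $ s / \<eta> x y) * berwald F s i j k x y))" for i j k
    by (intro rational_function_intros rational_metric assms)
  moreover have "landsberg F i j k x y / \<eta> x y = 1 / 2 * (\<Sum>m\<in>UNIV. \<Sum>s\<in>UNIV.
      y $ m * (metric F x y $ m $ s / \<eta> x y) * berwald F s i j k x y)" for i j k y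
    unfolding landsberg_def by (simp add: sum_divide_distrib mult_ac)
  ultimately have "rational_function (\<lambda>y. landsberg F i j k x y / \<eta> x y)" for i j k
    by (simp only:)
  then show ?thesis
    unfolding mean_landsberg_def by (intro rational_function_sum rational_contraction assms)
qed

lemma rational_mean_cartan:
  assumes "x \<in> D"
  shows "rational_function (mean_cartan F k x)"
proof -
  have "rational_function (\<lambda>y. 1 / 2 * (dy k (\<lambda>x y. metric F x y $ i $ j) x y / \<eta> x y))" for i j
    by (intro rational_function_intros rational_dy_over_\<eta> rational_metric assms)
  then have "rational_function (\<lambda>y. cartan F i j k x y / \<eta> x y)" for i j
    unfolding cartan_def by simp
  then show ?thesis
    unfolding mean_cartan_def by (intro rational_function_sum rational_contraction assms)
qed

text \<open>Rationality controls the mean Cartan torsion at generic points only. Continuity spreads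
  a nonzero value at one arbitrary point to an open set, which must contain generic points.\<close>

lemma continuous_mean_cartan:
  assumes "x \<in> D"
  shows "continuous_on (UNIV - {0}) (mean_cartan F k x)"
proof -
  have slice: "{y. (x, y) \<in> slit} = UNIV - {0}" using assms by auto
  have sm: "smooth_on slit (\<lambda>(x, y). metric F x y $ i $ j)" for i j
    using smooth_on_mult[OF open_slit smooth_on_const
        smooth_on_dy[OF open_slit smooth_on_dy[OF open_slit smooth_Fsq]], of "1 / 2"]
    unfolding metric_def by (simp add: case_prod_unfold)
  have g: "continuous_on (UNIV - {0}) (\<lambda>y. metric F x y $ i $ j)" for i j
    using smooth_on_slice[OF sm, of x] unfolding slice .
  have dg: "continuous_on (UNIV - {0}) (\<lambda>y. dy k (\<lambda>x y. metric F x y $ i $ j) x y)" for i j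
    using smooth_on_slice[OF smooth_on_dy[OF open_slit sm], of x] unfolding slice .
  have det: "det (metric F x y) \<noteq> 0" if "y \<in> UNIV - {0}" for y
    using pos_definite_det[OF metric_pos[OF assms]] that by simp
  have "continuous_on (UNIV - {0}) (\<lambda>y. if l = i then axis j 1 $ m else metric F x y $ m $ l)" for i j l m
    by (cases "l = i") (simp_all add: g)
  then have "continuous_on (UNIV - {0})
      (\<lambda>y. det (\<chi> m l. if l = i then axis j 1 $ m else metric F x y $ m $ l) / det (metric F x y))" for i j
    using det unfolding det_def by (intro continuous_intros g ballI) auto
  then have "continuous_on (UNIV - {0}) (\<lambda>y. metric_inv F x y $ i $ j)" for i j
    by (rule continuous_on_cong[THEN iffD1, rotated -1])
       (auto simp: metric_inv_def matrix_inv_cramer[OF det])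
  then show ?thesis
    unfolding mean_cartan_def cartan_def
    by (intro continuous_on_sum continuous_on_mult continuous_on_const dg)
qed

text \<open>A nonzero value would allow the isotropy equation to be solved for \<open>F\<close> as a
  quotient of rational functions. Here \<open>A\<close> is a number, since the base point
  \<open>x\<close> is fixed.\<close>

lemma isotropic_mean_landsberg_eq_0:
  assumes "x \<in> D" "y \<noteq> 0" "\<not> rational_function (F x)"
    and iso: "\<And>y. y \<noteq> 0 \<Longrightarrow> mean_landsberg F k x y = A * F x y * mean_cartan F k x y"
  shows "mean_landsberg F k x y = 0"
proof (rule ccontr)
  assume "mean_landsberg F k x y \<noteq> 0"
  then have nz: "A \<noteq> 0" "mean_cartan F k x y \<noteq> 0"
    using iso[OF assms(2)] by auto
  obtain P Q where PQ: "real_polynomial_function P" "real_polynomial_function Q" "\<exists>y. Q y \<noteq> 0"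
    "\<forall>\<^sub>F y in generic. mean_cartan F k x y = P y / Q y"
    using rational_mean_cartan[OF assms(1), of k] by (elim rational_functionE)
  define U where "U = (UNIV - {0}) \<inter> mean_cartan F k x -` (- {0})"
  have "open U"
    unfolding U_def
    by (rule continuous_open_preimage[OF continuous_mean_cartan[OF assms(1)]]) auto
  moreover have "y \<in> U" "0 \<notin> U" using assms(2) nz unfolding U_def by auto
  ultimately obtain z where "z \<in> U" "mean_cartan F k x z = P z / Q z"
    using generic_dense[OF PQ(4)] by blast
  \<comment> \<open>The numerator is thus not the zero polynomial, so the mean Cartan torsion is
    nonzero at every generic point and may be divided by.\<close>
  then have "P z \<noteq> 0" unfolding U_def by auto
  then have gen: "\<forall>\<^sub>F y in generic. P y \<noteq> 0" "\<forall>\<^sub>F y in generic. Q y \<noteq> 0"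
    using PQ eventually_generic_polynomial by blast+
  have "rational_function (\<lambda>y. mean_landsberg F k x y / (A * mean_cartan F k x y))"
    by (intro rational_function_intros rational_mean_landsberg rational_mean_cartan assms(1))
  moreover have "\<forall>\<^sub>F y in generic. F x y = mean_landsberg F k x y / (A * mean_cartan F k x y)"
    using eventually_generic_nonzero PQ(4) gen
  proof eventually_elim
    case (elim y)
    then show ?case using iso nz(1) by simp
  qed
  ultimately have "rational_function (F x)" by (rule rational_function_cong)
  with assms(3) show False ..
qed

end

section \<open>Homogeneity in induced coordinates\<close>

lemma chart_domain_subset:
  assumes "smooth_manifold M \<A>" "c \<in> \<A>"
  shows "fst c \<subseteq> topspace M"
  using assms unfolding smooth_manifold_def by (simp add: openin_subset)

lemma chart_inv_snd:
  assumes "smooth_manifold M \<A>" "c \<in> \<A>" "p \<in> fst c"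
  shows "chart_inv c (snd c p) = p"
proof -
  have h: "homeomorphic_map (subtopology M (fst c)) (top_of_set (chart_image c)) (snd c)"
    using assms(1,2) unfolding smooth_manifold_def by simp
  have "topspace (subtopology M (fst c)) = fst c"
    by (intro topspace_subtopology_subset chart_domain_subset[OF assms(1,2)])
  then have "inj_on (snd c) (fst c)"
    using homeomorphic_imp_injective_map[OF h] by simp
  then show ?thesis unfolding chart_inv_def using assms(3) by simp
qed

lemma chart_inv_in_domain:
  assumes "x \<in> chart_image c"
  shows "chart_inv c x \<in> fst c" "snd c (chart_inv c x) = x"
  using assms unfolding chart_inv_def chart_image_def by (auto intro: inv_into_into f_inv_into_f)

lemma open_chart_overlap:
  assumes "smooth_manifold M \<A>" "c \<in> \<A>" "d \<in> \<A>"
  shows "open (snd c ` (fst c \<inter> fst d))"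
proof -
  have *: "openin M (fst c)" "openin M (fst d)" "open (chart_image c)"
    "homeomorphic_map (subtopology M (fst c)) (top_of_set (chart_image c)) (snd c)"
    using assms unfolding smooth_manifold_def by auto
  have "openin (subtopology M (fst c)) (fst c \<inter> fst d)"
    using *(2) by (simp add: openin_subtopology_Int2)
  then have "openin (top_of_set (chart_image c)) (snd c ` (fst c \<inter> fst d))"
    using homeomorphic_imp_open_map[OF *(4)] unfolding open_map_def by blast
  then show ?thesis using *(3) openin_open_trans by blast
qed

lemma chart_change_has_derivative:
  assumes "smooth_manifold M \<A>" "c \<in> \<A>" "d \<in> \<A>" "p \<in> fst c" "p \<in> fst d"
  shows "((snd d \<circ> chart_inv c) has_derivative chart_change p c d) (at (snd c p))"
proof -
  have "smooth_on (snd c ` (fst c \<inter> fst d)) (snd d \<circ> chart_inv c)"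
    using assms unfolding smooth_manifold_def by blast
  then have "(snd d \<circ> chart_inv c) differentiable (at (snd c p))"
    by (rule smooth_on_differentiable) (use assms in auto)
  then show ?thesis
    unfolding chart_change_def by (rule frechet_derivative_works[THEN iffD1])
qed

text \<open>The chain rule for transition maps, together with uniqueness of derivatives. The
  composite agrees with the direct transition map on the overlap, which is open and contains the
  base point.\<close>

lemma chart_change_compose:
  assumes M: "smooth_manifold M \<A>" and cs: "c \<in> \<A>" "d \<in> \<A>" "e \<in> \<A>"
    and p: "p \<in> fst c" "p \<in> fst d" "p \<in> fst e"
  shows "chart_change p c e y = chart_change p d e (chart_change p c d y)"
proof -
  have "((snd e \<circ> chart_inv d) has_derivative chart_change p d e) (at ((snd d \<circ> chart_inv c) (snd c p)))"
    using chart_change_has_derivative[OF M cs(2,3) p(2,3)] chart_inv_snd[OF M cs(1) p(1)] by simp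
  with chart_change_has_derivative[OF M cs(1,2) p(1,2)]
  have "((snd e \<circ> chart_inv d) \<circ> (snd d \<circ> chart_inv c) has_derivative chart_change p d e \<circ> chart_change p c d) (at (snd c p))"
    by (rule diff_chain_at)
  then have "((snd e \<circ> chart_inv c) has_derivative chart_change p d e \<circ> chart_change p c d) (at (snd c p))"
  proof (rule has_derivative_transform_within_open[OF _ open_chart_overlap[OF M cs(1,2)]])
    show "((snd e \<circ> chart_inv d) \<circ> (snd d \<circ> chart_inv c)) x = (snd e \<circ> chart_inv c) x"
      if "x \<in> snd c ` (fst c \<inter> fst d)" for x
      using that chart_inv_snd[OF M cs(1)] chart_inv_snd[OF M cs(2)] by auto
  qed (use p in auto)
  from has_derivative_unique[OF this chart_change_has_derivative[OF M cs(1,3) p(1,3)]]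
  show ?thesis by (metis comp_apply)
qed

text \<open>The cocycle identity \<open>chart_change_compose\<close> is exactly the compatibility
  demanded by \<open>tangent_space\<close>. Membership matters because homogeneity in
  \<open>Finsler_metric\<close> is stated for elements of the bundle.\<close>

lemma tangent_of_coords_in_bundle:
  assumes M: "smooth_manifold M \<A>" and c: "c \<in> \<A>" "p \<in> fst c"
  shows "(p, tangent_of_coords \<A> c p y) \<in> tangent_bundle M \<A>"
proof -
  have "tangent_of_coords \<A> c p y \<in> tangent_space \<A> p"
    unfolding tangent_space_def
  proof (intro CollectI conjI allI ballI impI)
    fix d e assume de: "d \<in> \<A>" "e \<in> \<A>" "p \<in> fst d \<and> p \<in> fst e"
    then show "tangent_of_coords \<A> c p y e = chart_change p d e (tangent_of_coords \<A> c p y d)"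
      using chart_change_compose[OF M c(1) de(1,2) c(2), of y] by (simp add: tangent_of_coords_def)
  qed (auto simp: tangent_of_coords_def)
  moreover have "p \<in> topspace M" using chart_domain_subset[OF M c(1)] c(2) by blast
  ultimately show ?thesis by (simp add: tangent_bundle_def)
qed

lemma tangent_of_coords_scaleR:
  assumes M: "smooth_manifold M \<A>" and c: "c \<in> \<A>" "p \<in> fst c"
  shows "tangent_of_coords \<A> c p (r *\<^sub>R y) = (\<lambda>d. r *\<^sub>R tangent_of_coords \<A> c p y d)"
proof -
  have "linear (chart_change p c d)" if "d \<in> \<A>" "p \<in> fst d" for d
    using chart_change_has_derivative[OF M c(1) that(1) c(2) that(2)] has_derivative_linear by blast
  then show ?thesis unfolding tangent_of_coords_def by (auto simp: linear_cmul)
qed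

lemma local_rep_homogeneous:
  assumes "smooth_manifold M \<A>" "Finsler_metric M \<A> F" "c \<in> \<A>" "x \<in> chart_image c" "r > 0"
  shows "local_rep \<A> c F x (r *\<^sub>R y) = r * local_rep \<A> c F x y"
proof -
  note p = chart_inv_in_domain(1)[OF assms(4)]
  have "\<forall>(p, v)\<in>tangent_bundle M \<A>. \<forall>r>0. F (p, \<lambda>c. r *\<^sub>R v c) = r * F (p, v)"
    using assms(2) unfolding Finsler_metric_def by (elim conjE)
  from bspec[OF this tangent_of_coords_in_bundle[OF assms(1,3) p]] assms(5)
  show ?thesis
    unfolding local_rep_def tangent_of_coords_scaleR[OF assms(1,3) p] by simp
qed

section \<open>From single charts to the manifold\<close>

theorem theorem3p21:
  fixes M :: "'a topology"
    and \<A> :: "('a, 'n::finite) chart set"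
    and F \<eta> :: "'a \<times> ('a, 'n) tangent \<Rightarrow> real"
    and a :: "('a, 'n) chart \<Rightarrow> real ^ 'n \<Rightarrow> real ^ 'n \<Rightarrow> real ^ 'n ^ 'n"
  assumes "CARD('n) \<ge> 2"
    and "AR_Finsler_manifold M \<A> F \<eta> a"
    and "\<And>c x. c \<in> \<A> \<Longrightarrow> x \<in> chart_image c \<Longrightarrow> \<not> rational_function (\<lambda>y. local_rep \<A> c F x y)"
    and "\<And>c i. c \<in> \<A> \<Longrightarrow>
           rational_in_fibre (chart_image c) (dx i (\<lambda>x y. ln (local_rep \<A> c \<eta> x y)))"
    and "isotropic_mean_Landsberg \<A> F"
  shows "weakly_Landsberg \<A> F"
proof -
  have M: "smooth_manifold M \<A>" and Fins: "Finsler_metric M \<A> F" and \<eta>: "smooth_on_slit \<A> \<eta>"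
    and rat: "\<And>c i j. c \<in> \<A> \<Longrightarrow> rational_in_fibre (chart_image c) (\<lambda>x y. a c x y $ i $ j)"
    and pt: "\<And>c x y. c \<in> \<A> \<Longrightarrow> x \<in> chart_image c \<Longrightarrow> y \<noteq> 0 \<Longrightarrow> pos_definite (a c x y) \<and>
      (\<forall>i j. metric (local_rep \<A> c F) x y $ i $ j = local_rep \<A> c \<eta> x y * a c x y $ i $ j)"
    using assms(2) by (simp_all only: AR_Finsler_manifold_def bex_simps simp_thms)
  obtain A where A: "\<And>c x y k. c \<in> \<A> \<Longrightarrow> x \<in> chart_image c \<Longrightarrow> y \<noteq> 0 \<Longrightarrow>
      mean_landsberg (local_rep \<A> c F) k x y =
      A (chart_inv c x) * local_rep \<A> c F x y * mean_cartan (local_rep \<A> c F) k x y"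
    using assms(5) unfolding isotropic_mean_Landsberg_def by blast
  have "mean_landsberg (local_rep \<A> c F) k x y = 0"
    if c: "c \<in> \<A>" and x: "x \<in> chart_image c" and y: "y \<noteq> 0" for c x y k
  proof -
    interpret AR_Finsler_chart "chart_image c" "local_rep \<A> c F" "local_rep \<A> c \<eta>" "a c"
    proof
      show "open (chart_image c)"
        using M c unfolding smooth_manifold_def by simp
      show "smooth_on (chart_image c \<times> (UNIV - {0})) (\<lambda>(x, y). local_rep \<A> c F x y)"
        using Fins c unfolding Finsler_metric_def smooth_on_slit_def by simp
      show "smooth_on (chart_image c \<times> (UNIV - {0})) (\<lambda>(x, y). local_rep \<A> c \<eta> x y)"
        using \<eta> c unfolding smooth_on_slit_def by simp
      show "local_rep \<A> c F x (r *\<^sub>R y) = r * local_rep \<A> c F x y"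
        if "x \<in> chart_image c" "r > 0" for x y r
        by (rule local_rep_homogeneous[OF M Fins c that])
      show "pos_definite (metric (local_rep \<A> c F) x y)" if "x \<in> chart_image c" "y \<noteq> 0" for x y
        using Fins c that unfolding Finsler_metric_def by simp
      show "pos_definite (a c x y)" if "x \<in> chart_image c" "y \<noteq> 0" for x y
        using pt[OF c that] by simp
      show "metric (local_rep \<A> c F) x y = local_rep \<A> c \<eta> x y *\<^sub>R a c x y"
        if "x \<in> chart_image c" "y \<noteq> 0" for x y
        using pt[OF c that] by (simp add: vec_eq_iff)
      show "rational_in_fibre (chart_image c) (\<lambda>x y. a c x y $ i $ j)" for i j
        by (rule rat[OF c])
      show "rational_in_fibre (chart_image c) (dx i (\<lambda>x y. ln (local_rep \<A> c \<eta> x y)))" for i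
        by (rule assms(4)[OF c])
    qed
    show ?thesis
      \<comment> \<open>The constant of the chart lemma is instantiated with the value of
        \<open>A\<close> at the point \<open>chart_inv c x\<close>.\<close>
      by (rule isotropic_mean_landsberg_eq_0[OF x y assms(3)[OF c x] A[OF c x]])
  qed
  then show ?thesis unfolding weakly_Landsberg_def by blast
qed

end
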